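(* Let $\Omega\subset\mathbb{R}^3$ be a bounded strong Lipschitz domain. The regular (type) direct decomposition $$H^{0,-1}_{\mathbb S}(\mathrm{divDiv},\Omega)=\mathring H^1(\Omega)\cdot I\;\dotplus\;H_{\mathbb S}(\mathrm{divDiv}_0,\Omega)$$ holds. More precisely, for $M\in H^{0,-1}_{\mathbb S}(\mathrm{divDiv},\Omega)$ there are unique $u\in\mathring H^1(\Omega)$ and $M_0\in H_{\mathbb S}(\mathrm{divDiv}_0,\Omega)$ such that $M=u\,I+M_0$. The scalar function $u\in\mathring H^1(\Omega)$ is given as the unique solution of the Dirichlet-Poisson problem $$\langle\mathrm{grad}\,u,\mathrm{grad}\,\varphi\rangle_{L^2(\Omega)}=-\langle\mathrm{divDiv}M,\varphi\rangle_{H^{-1}(\Omega)}\quad\text{for all }\varphi\in\mathring H^1(\Omega),$$ and the decomposition is continuous; more precisely, there exists $c>0$ (independent of $M$) such that $$|u|_{H^1(\Omega)}\le c\,|\mathrm{divDiv}M|_{H^{-1}(\Omega)},\qquad |M-u\,I|_{L^2(\Omega)}\le c\,|M|_{H^{0,-1}_{\mathbb S}(\mathrm{divDiv},\Omega)}.$$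
   Context: Strong Lipschitz: the boundary $\Gamma=\partial\Omega$ is locally the graph of a Lipschitz function $\psi:U\subset\mathbb{R}^2\to\mathbb{R}$. All fields are real. $\mathring H^1(\Omega)$ is the closure of the compactly supported smooth functions in $H^1(\Omega)$, $H^{-1}(\Omega)=(\mathring H^1(\Omega))'$, and $\langle\cdot,\cdot\rangle_{H^{-1}(\Omega)}$ is the duality pairing. $I$ is the $3\times3$ identity matrix and $\mathring H^1(\Omega)\cdot I=\{u\,I:u\in\mathring H^1(\Omega)\}$ (scalar $u$). For a $3\times3$-tensor field $M$, $\mathrm{Div}M$ is the row-wise divergence and $\mathrm{divDiv}M=\mathrm{div}(\mathrm{Div}M)$ in the distributional sense. $L^2_{\mathbb S}(\Omega)$ is the space of symmetric tensor fields in $L^2(\Omega)$; $H^{0,-1}_{\mathbb S}(\mathrm{divDiv},\Omega)=\{M\in L^2_{\mathbb S}(\Omega):\mathrm{divDiv}M\in H^{-1}(\Omega)\}$ with the graph norm $\big(|M|_{L^2(\Omega)}^2+|\mathrm{divDiv}M|_{H^{-1}(\Omega)}^2\big)^{1/2}$; $H_{\mathbb S}(\mathrm{divDiv}_0,\Omega)=\{M\in L^2_{\mathbb S}(\Omega):\mathrm{divDiv}M=0\}$. $\dotplus$ denotes the direct sum. *)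

theory Defs
  imports "HOL-Analysis.Analysis"
begin

text \<open>
  Fields on \<open>\<Omega>\<close> are represented by functions on the whole space of which only the values on \<open>\<Omega>\<close>
  matter; two fields are identified when they agree almost everywhere on \<open>\<Omega>\<close>.  All spaces of
  fields below, except for the test functions, are closed under this identification.
\<close>

type_synonym scalar_field = "real^3 \<Rightarrow> real"
type_synonym vector_field = "real^3 \<Rightarrow> real^3"
type_synonym tensor_field = "real^3 \<Rightarrow> real^3^3"

definition ae_eq :: "(real^3) set \<Rightarrow> (real^3 \<Rightarrow> 'b) \<Rightarrow> (real^3 \<Rightarrow> 'b) \<Rightarrow> bool" where
  "ae_eq \<Omega> f g \<longleftrightarrow> (AE x in lebesgue_on \<Omega>. f x = g x)"


section \<open>Bounded strong Lipschitz domains\<close>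

text \<open>
  The map \<open>T\<close> supplies the local Cartesian coordinates; translations are absorbed into \<open>U\<close> and
  \<open>\<psi>\<close>.
\<close>

definition strong_lipschitz_boundary :: "(real^3) set \<Rightarrow> bool" where
  "strong_lipschitz_boundary \<Omega> \<longleftrightarrow>
     (\<forall>x\<in>frontier \<Omega>. \<exists>W (T :: real^3 \<Rightarrow> real^3) (U :: (real^2) set) (\<psi> :: real^2 \<Rightarrow> real) L.
        open W \<and> x \<in> W \<and> orthogonal_transformation T \<and> open U \<and> L-lipschitz_on U \<psi> \<and>
        frontier \<Omega> \<inter> W = T ` {vector [y $ 1, y $ 2, \<psi> y] | y. y \<in> U})"

definition bounded_strong_lipschitz_domain :: "(real^3) set \<Rightarrow> bool" where
  "bounded_strong_lipschitz_domain \<Omega> \<longleftrightarrow>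
     open \<Omega> \<and> connected \<Omega> \<and> \<Omega> \<noteq> {} \<and> bounded \<Omega> \<and> strong_lipschitz_boundary \<Omega>"


section \<open>Test functions and distributional derivatives\<close>

definition partial :: "3 \<Rightarrow> scalar_field \<Rightarrow> scalar_field" where
  "partial i f = (\<lambda>x. frechet_derivative f (at x) (axis i 1))"

primrec Ck :: "nat \<Rightarrow> scalar_field \<Rightarrow> bool" where
  "Ck 0 f \<longleftrightarrow> continuous_on UNIV f"
| "Ck (Suc k) f \<longleftrightarrow> (\<forall>x. f differentiable (at x)) \<and> (\<forall>i. Ck k (partial i f))"

definition test_functions :: "(real^3) set \<Rightarrow> scalar_field set" where
  "test_functions \<Omega> =
     {\<phi>. (\<forall>k. Ck k \<phi>) \<and> compact (closure {x. \<phi> x \<noteq> 0}) \<and> closure {x. \<phi> x \<noteq> 0} \<subseteq> \<Omega>}"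

text \<open>
  Distributions on \<open>\<Omega>\<close> are functionals of which only the values on \<open>test_functions \<Omega>\<close> matter.
  Continuity is not part of the type: all distributions below are derivatives of \<open>L\<^sup>2\<close> fields.
\<close>

type_synonym distribution = "scalar_field \<Rightarrow> real"

definition distr_of :: "(real^3) set \<Rightarrow> scalar_field \<Rightarrow> distribution" where
  "distr_of \<Omega> f = (\<lambda>\<phi>. \<integral>x. f x * \<phi> x \<partial>lebesgue_on \<Omega>)"

definition distr_partial :: "3 \<Rightarrow> distribution \<Rightarrow> distribution" where
  "distr_partial i T = (\<lambda>\<phi>. - T (partial i \<phi>))"

definition distr_div :: "(3 \<Rightarrow> distribution) \<Rightarrow> distribution" where
  "distr_div T = (\<lambda>\<phi>. \<Sum>i\<in>UNIV. distr_partial i (T i) \<phi>)"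

definition distr_Div :: "(real^3) set \<Rightarrow> tensor_field \<Rightarrow> 3 \<Rightarrow> distribution" where
  "distr_Div \<Omega> M = (\<lambda>i. distr_div (\<lambda>j. distr_of \<Omega> (\<lambda>x. M x $ i $ j)))"

definition divDiv :: "(real^3) set \<Rightarrow> tensor_field \<Rightarrow> distribution" where
  "divDiv \<Omega> M = distr_div (distr_Div \<Omega> M)"


section \<open>Lebesgue and Sobolev spaces\<close>

definition L2 :: "(real^3) set \<Rightarrow> (real^3 \<Rightarrow> 'b::euclidean_space) set" where
  "L2 \<Omega> = {f. f \<in> borel_measurable (lebesgue_on \<Omega>) \<and>
              integrable (lebesgue_on \<Omega>) (\<lambda>x. (norm (f x))\<^sup>2)}"

text \<open>For tensor fields the pointwise inner product is the Frobenius product.\<close>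

definition L2_inner ::
  "(real^3) set \<Rightarrow> (real^3 \<Rightarrow> 'b::euclidean_space) \<Rightarrow> (real^3 \<Rightarrow> 'b) \<Rightarrow> real" where
  "L2_inner \<Omega> f g = (\<integral>x. f x \<bullet> g x \<partial>lebesgue_on \<Omega>)"

definition L2_norm :: "(real^3) set \<Rightarrow> (real^3 \<Rightarrow> 'b::euclidean_space) \<Rightarrow> real" where
  "L2_norm \<Omega> f = sqrt (L2_inner \<Omega> f f)"

definition has_weak_grad :: "(real^3) set \<Rightarrow> scalar_field \<Rightarrow> vector_field \<Rightarrow> bool" where
  "has_weak_grad \<Omega> u g \<longleftrightarrow>
     (\<forall>i. \<forall>\<phi>\<in>test_functions \<Omega>.
        distr_partial i (distr_of \<Omega> u) \<phi> = distr_of \<Omega> (\<lambda>x. g x $ i) \<phi>)"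

definition H1 :: "(real^3) set \<Rightarrow> scalar_field set" where
  "H1 \<Omega> = {u \<in> L2 \<Omega>. \<exists>g\<in>L2 \<Omega>. has_weak_grad \<Omega> u g}"

text \<open>The weak gradient is determined up to equality almost everywhere.\<close>

definition grad :: "(real^3) set \<Rightarrow> scalar_field \<Rightarrow> vector_field" where
  "grad \<Omega> u = (SOME g. g \<in> L2 \<Omega> \<and> has_weak_grad \<Omega> u g)"

definition H1_norm :: "(real^3) set \<Rightarrow> scalar_field \<Rightarrow> real" where
  "H1_norm \<Omega> u = sqrt ((L2_norm \<Omega> u)\<^sup>2 + (L2_norm \<Omega> (grad \<Omega> u))\<^sup>2)"

definition H1_0 :: "(real^3) set \<Rightarrow> scalar_field set" where
  "H1_0 \<Omega> = {u \<in> H1 \<Omega>. \<forall>e>0. \<exists>\<phi>\<in>test_functions \<Omega>. H1_norm \<Omega> (\<lambda>x. u x - \<phi> x) < e}"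

text \<open>
  Elements of the dual space of \<open>H1_0 \<Omega>\<close> are extended by \<open>0\<close> outside of it, so that they are
  equal as functions if and only if they are equal as functionals on \<open>H1_0 \<Omega>\<close>.
\<close>

definition H_minus1 :: "(real^3) set \<Rightarrow> (scalar_field \<Rightarrow> real) set" where
  "H_minus1 \<Omega> =
     {F. (\<forall>u\<in>H1_0 \<Omega>. \<forall>v\<in>H1_0 \<Omega>. F (\<lambda>x. u x + v x) = F u + F v) \<and>
         (\<forall>c. \<forall>u\<in>H1_0 \<Omega>. F (\<lambda>x. c * u x) = c * F u) \<and>
         (\<exists>C. \<forall>u\<in>H1_0 \<Omega>. \<bar>F u\<bar> \<le> C * H1_norm \<Omega> u) \<and>
         (\<forall>u. u \<notin> H1_0 \<Omega> \<longrightarrow> F u = 0)}"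

definition H_minus1_norm :: "(real^3) set \<Rightarrow> (scalar_field \<Rightarrow> real) \<Rightarrow> real" where
  "H_minus1_norm \<Omega> F = (SUP u\<in>{u \<in> H1_0 \<Omega>. H1_norm \<Omega> u \<le> 1}. \<bar>F u\<bar>)"

definition distr_in_H_minus1 :: "(real^3) set \<Rightarrow> distribution \<Rightarrow> bool" where
  "distr_in_H_minus1 \<Omega> T \<longleftrightarrow> (\<exists>F\<in>H_minus1 \<Omega>. \<forall>\<phi>\<in>test_functions \<Omega>. F \<phi> = T \<phi>)"

text \<open>The extension is unique because the test functions are dense in \<open>H1_0 \<Omega>\<close>.\<close>

definition H_minus1_of :: "(real^3) set \<Rightarrow> distribution \<Rightarrow> scalar_field \<Rightarrow> real" where
  "H_minus1_of \<Omega> T = (THE F. F \<in> H_minus1 \<Omega> \<and> (\<forall>\<phi>\<in>test_functions \<Omega>. F \<phi> = T \<phi>))"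


section \<open>Spaces of tensor fields\<close>

definition L2_sym :: "(real^3) set \<Rightarrow> tensor_field set" where
  "L2_sym \<Omega> = {M \<in> L2 \<Omega>. ae_eq \<Omega> (\<lambda>x. transpose (M x)) M}"

definition H_sym_divDiv :: "(real^3) set \<Rightarrow> tensor_field set" where
  "H_sym_divDiv \<Omega> = {M \<in> L2_sym \<Omega>. distr_in_H_minus1 \<Omega> (divDiv \<Omega> M)}"

definition divDiv_H_minus1 :: "(real^3) set \<Rightarrow> tensor_field \<Rightarrow> scalar_field \<Rightarrow> real" where
  "divDiv_H_minus1 \<Omega> M = H_minus1_of \<Omega> (divDiv \<Omega> M)"

definition H_sym_divDiv_norm :: "(real^3) set \<Rightarrow> tensor_field \<Rightarrow> real" where
  "H_sym_divDiv_norm \<Omega> M =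
     sqrt ((L2_norm \<Omega> M)\<^sup>2 + (H_minus1_norm \<Omega> (divDiv_H_minus1 \<Omega> M))\<^sup>2)"

definition H_sym_divDiv0 :: "(real^3) set \<Rightarrow> tensor_field set" where
  "H_sym_divDiv0 \<Omega> = {M \<in> L2_sym \<Omega>. \<forall>\<phi>\<in>test_functions \<Omega>. divDiv \<Omega> M \<phi> = 0}"

definition times_I :: "scalar_field \<Rightarrow> tensor_field" where
  "times_I u = (\<lambda>x. u x *\<^sub>R mat 1)"

definition H1_0_I :: "(real^3) set \<Rightarrow> tensor_field set" where
  "H1_0_I \<Omega> = {M. \<exists>u\<in>H1_0 \<Omega>. ae_eq \<Omega> M (times_I u)}"

definition is_direct_sum ::
  "(real^3) set \<Rightarrow> tensor_field set \<Rightarrow> tensor_field set \<Rightarrow> tensor_field set \<Rightarrow> bool" where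
  "is_direct_sum \<Omega> V A B \<longleftrightarrow>
     V = {\<lambda>x. P x + Q x | P Q. P \<in> A \<and> Q \<in> B} \<and>
     (\<forall>P \<in> A \<inter> B. ae_eq \<Omega> P (\<lambda>x. 0))"

definition solves_dirichlet_poisson ::
  "(real^3) set \<Rightarrow> tensor_field \<Rightarrow> scalar_field \<Rightarrow> bool" where
  "solves_dirichlet_poisson \<Omega> M u \<longleftrightarrow>
     u \<in> H1_0 \<Omega> \<and>
     (\<forall>\<phi>\<in>H1_0 \<Omega>. L2_inner \<Omega> (grad \<Omega> u) (grad \<Omega> \<phi>) = - divDiv_H_minus1 \<Omega> M \<phi>)"

end

theory Submission
  imports Defs
begin

text \<open>
  The decomposition is the Dirichlet problem in disguise.  For \<open>u\<close> in \<open>H1_0 \<Omega>\<close> the distribution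
  \<open>divDiv (u I)\<close> is the Laplacian of \<open>u\<close> (\<open>divDiv_times_I\<close>), so \<open>M - u I\<close> has vanishing \<open>divDiv\<close>
  if and only if \<open>u\<close> solves the Dirichlet-Poisson problem with right-hand side \<open>divDiv M\<close>
  (\<open>solves_dirichlet_poisson_iff\<close>).  Existence, uniqueness and stability of the decomposition are
  therefore those of this problem, and follow from the Riesz representation theorem for the energy
  inner product (\<open>Dirichlet_problem_solvable\<close>) and the Poincare inequality (\<open>Poincare\<close>).

  The analysis behind this is developed from integration theory.  Translation invariance of the
  Lebesgue measure shows that derivatives of compactly supported \<open>C\<^sup>1\<close> functions have integral
  zero (\<open>integral_partial_eq_0\<close>).  Applied to a product this is integration by parts, so that the
  classical gradient of a test function is a weak gradient; applied to \<open>x\<^sub>i f\<^sup>2\<close> it is the Poincare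
  inequality.  Weak gradients are unique by the fundamental lemma of the calculus of variations,
  for which smooth functions approximate indicator functions of boxes.  The representation theorem
  is proved by minimizing the energy functional over the test functions; a minimizing sequence
  converges because \<open>L\<^sup>2\<close> is complete (\<open>L2_complete\<close>).
\<close>

section \<open>Calculus of smooth functions\<close>

lemma partial_eqI:
  assumes "(f has_derivative f') (at x)"
  shows "partial i f x = f' (axis i 1)"
  using frechet_derivative_at[OF assms] by (simp add: partial_def)

lemma partial_add:
  assumes "f differentiable at x" "g differentiable at x"
  shows "partial i (\<lambda>x. f x + g x) x = partial i f x + partial i g x"
  using partial_eqI[OF has_derivative_add[OF assms[unfolded frechet_derivative_works]]]
  by (simp add: partial_def)

lemma partial_mult:
  assumes "f differentiable at x" "g differentiable at x"
  shows "partial i (\<lambda>x. f x * g x) x = f x * partial i g x + partial i f x * g x"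
  using partial_eqI[OF has_derivative_mult[OF assms[unfolded frechet_derivative_works]]]
  by (simp add: partial_def)

lemma partial_const [simp]: "partial i (\<lambda>x. c) = (\<lambda>x. 0)"
  by (auto simp: fun_eq_iff intro!: partial_eqI derivative_eq_intros)

lemma Ck_const [simp]: "Ck k (\<lambda>x. c)"
  by (induction k arbitrary: c) auto

lemma Ck_imp_continuous:
  "Ck k f \<Longrightarrow> continuous_on UNIV f"
  by (cases k)
    (auto simp: continuous_on_eq_continuous_at differentiable_imp_continuous_within)

lemma Ck_Suc_imp_Ck: "Ck (Suc k) f \<Longrightarrow> Ck k f"
proof (induction k arbitrary: f)
  case 0
  then show ?case using Ck_imp_continuous[OF 0] by simp
next
  case (Suc k)
  then show ?case by (metis Ck.simps(2))
qed

lemma Ck_add: "Ck k f \<Longrightarrow> Ck k g \<Longrightarrow> Ck k (\<lambda>x. f x + g x)"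
proof (induction k arbitrary: f g)
  case 0
  then show ?case by (auto intro: continuous_intros)
next
  case (Suc k)
  have "partial i (\<lambda>x. f x + g x) = (\<lambda>x. partial i f x + partial i g x)" for i
    using Suc.prems by (auto simp: partial_add)
  then show ?case using Suc by auto
qed

lemma Ck_mult: "Ck k f \<Longrightarrow> Ck k g \<Longrightarrow> Ck k (\<lambda>x. f x * g x)"
proof (induction k arbitrary: f g)
  case 0
  then show ?case by (auto intro: continuous_intros)
next
  case (Suc k)
  have "partial i (\<lambda>x. f x * g x) = (\<lambda>x. f x * partial i g x + partial i f x * g x)" for i
    using Suc.prems by (auto simp: partial_mult)
  moreover have "Ck k (\<lambda>x. f x * partial i g x + partial i f x * g x)" for i
    by (intro Ck_add Suc.IH) (use Suc.prems Ck_Suc_imp_Ck in auto)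
  ultimately show ?case using Suc.prems by auto
qed

lemma Ck_prod:
  assumes "finite A" "\<And>i. i \<in> A \<Longrightarrow> Ck k (f i)"
  shows "Ck k (\<lambda>x. \<Prod>i\<in>A. f i x)"
  using assms by (induction A rule: finite_induct) (auto intro: Ck_mult)

lemma Ck_partial: "Ck (Suc k) f \<Longrightarrow> Ck k (partial i f)"
  by simp

lemma partial_coordinate: "partial i (\<lambda>x. x $ j) x = (if i = j then 1 else 0)"
proof -
  have "((\<lambda>x. x $ j) has_derivative (\<lambda>h. h $ j)) (at x)"
    by (intro bounded_linear.has_derivative[OF bounded_linear_vec_nth] has_derivative_ident)
  from partial_eqI[OF this] show ?thesis by (simp add: axis_def)
qed

lemma Ck_coordinate: "Ck k (\<lambda>x. x $ j)"
proof (cases k)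
  case (Suc l)
  have "Ck l (partial i (\<lambda>x. x $ j))" for i
    by (cases "i = j") (simp_all add: partial_coordinate[abs_def])
  then show ?thesis
    by (auto simp: Suc intro: bounded_linear_imp_differentiable bounded_linear_vec_nth)
qed (auto intro: continuous_intros)

text \<open>
  For \<open>c > 0\<close> the functions \<open>t \<mapsto> t\<^sup>-\<^sup>m exp (- c / t)\<close>, extended by \<open>0\<close> to \<open>t \<le> 0\<close>, span a
  space which is closed under differentiation; hence they are smooth.
\<close>

definition flat_exp :: "real \<Rightarrow> nat \<Rightarrow> real \<Rightarrow> real" where
  "flat_exp c m t = (if t > 0 then inverse t ^ m * exp (- (c * inverse t)) else 0)"

lemma flat_exp_tendsto_0:
  assumes "c > 0"
  shows "(flat_exp c m \<longlongrightarrow> 0) (at 0)"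
proof (rule filterlim_split_at)
  show "(flat_exp c m \<longlongrightarrow> 0) (at_left 0)"
    by (rule Lim_transform_eventually[OF tendsto_const])
      (auto simp: flat_exp_def eventually_at_filter)
  have "filterlim (\<lambda>t. c * inverse t) at_top (at_right (0::real))"
    using assms by (intro filterlim_tendsto_pos_mult_at_top[OF tendsto_const]
        filterlim_inverse_at_top_right)
  from filterlim_compose[OF tendsto_power_div_exp_0 this]
  have "((\<lambda>t. (c * inverse t) ^ m / exp (c * inverse t)) \<longlongrightarrow> 0) (at_right 0)" .
  then have "((\<lambda>t. inverse (c ^ m) * ((c * inverse t) ^ m / exp (c * inverse t))) \<longlongrightarrow>
      inverse (c ^ m) * 0) (at_right 0)"
    by (intro tendsto_intros)
  then have *: "((\<lambda>t. inverse (c ^ m) * ((c * inverse t) ^ m / exp (c * inverse t))) \<longlongrightarrow> 0)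
      (at_right 0)"
    by simp
  show "(flat_exp c m \<longlongrightarrow> 0) (at_right 0)"
    by (rule Lim_transform_eventually[OF *])
      (use assms in \<open>auto simp: flat_exp_def eventually_at_filter power_mult_distrib
        exp_minus field_simps\<close>)
qed

lemma flat_exp_has_derivative:
  assumes c: "c > 0"
  shows "(flat_exp c m has_real_derivative
           c * flat_exp c (m + 2) t - real m * flat_exp c (m + 1) t) (at t)"
proof (cases t "0::real" rule: linorder_cases)
  case less
  have "((\<lambda>_. 0) has_real_derivative 0) (at t)" by simp
  moreover have "\<forall>\<^sub>F s in nhds t. flat_exp c m s = 0"
    using less eventually_nhds_in_open[of "{..<0}" t]
    by (auto elim!: eventually_mono simp: flat_exp_def)
  ultimately have "(flat_exp c m has_real_derivative 0) (at t)"
    by (subst DERIV_cong_ev[OF refl _ refl]) auto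
  then show ?thesis using less by (simp add: flat_exp_def)
next
  case equal
  have "((\<lambda>s. (flat_exp c m s - flat_exp c m 0) / (s - 0)) \<longlongrightarrow> 0) (at 0)"
    by (rule Lim_transform_eventually[OF flat_exp_tendsto_0[OF c, of "Suc m"]])
      (auto simp: flat_exp_def eventually_at_filter field_simps)
  then show ?thesis
    by (auto simp: equal has_field_derivative_iff flat_exp_def)
next
  case greater
  have "((\<lambda>s. inverse s ^ m * exp (- (c * inverse s))) has_real_derivative
      c * flat_exp c (m + 2) t - real m * flat_exp c (m + 1) t) (at t)"
    using greater
    apply (auto intro!: derivative_eq_intros simp: flat_exp_def)
    apply (cases m)
    apply (auto simp: field_simps power2_eq_square)
    done
  moreover have "\<forall>\<^sub>F s in nhds t. flat_exp c m s = inverse s ^ m * exp (- (c * inverse s))"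
    using greater eventually_nhds_in_open[of "{0<..}" t]
    by (auto elim!: eventually_mono simp: flat_exp_def)
  ultimately show ?thesis
    by (subst DERIV_cong_ev[OF refl _ refl]) auto
qed

lemma Ck_flat_exp_affine:
  assumes c: "c > 0"
  shows "Ck k (\<lambda>x. flat_exp c m (s * x $ j + d))"
proof (induction k arbitrary: m)
  case 0
  have "continuous_on UNIV (flat_exp c m)"
    by (intro continuous_at_imp_continuous_on ballI DERIV_isCont[OF flat_exp_has_derivative[OF c]])
  then have "continuous_on UNIV (\<lambda>x. flat_exp c m (s * x $ j + d))"
    by (rule continuous_on_compose2) (auto intro!: continuous_intros)
  then show ?case by simp
next
  case (Suc k)
  have 1: "((\<lambda>x. flat_exp c m (s * x $ j + d)) has_derivative
     (\<lambda>h. (c * flat_exp c (m + 2) (s * x $ j + d) - real m * flat_exp c (m + 1) (s * x $ j + d))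
       * (s * h $ j))) (at x)" for x :: "real^3"
  proof (rule has_derivative_compose[OF _ flat_exp_has_derivative[OF c, unfolded has_field_derivative_def]])
    show "((\<lambda>x. s * x $ j + d) has_derivative (\<lambda>h. s * h $ j)) (at x)"
      by (auto intro!: derivative_eq_intros bounded_linear.has_derivative[OF bounded_linear_vec_nth])
  qed
  have 2: "partial i (\<lambda>x. flat_exp c m (s * x $ j + d)) =
     (\<lambda>x. (s * axis i 1 $ j) * (c * flat_exp c (m + 2) (s * x $ j + d)
        + (- real m) * flat_exp c (m + 1) (s * x $ j + d)))" for i
    by (simp add: fun_eq_iff partial_eqI[OF 1])
  have "Ck k (partial i (\<lambda>x. flat_exp c m (s * x $ j + d)))" for i
    unfolding 2 by (intro Ck_add Ck_mult Ck_const Suc.IH)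
  then show ?case
    using 1 by (auto simp: differentiable_def)
qed

section \<open>Integration by parts\<close>

lemma integrable_continuous_bounded_support:
  fixes f :: "'a::euclidean_space \<Rightarrow> real"
  assumes "continuous_on UNIV f" "bounded {x. f x \<noteq> 0}"
  shows "integrable lebesgue f"
proof -
  obtain a where a: "{x. f x \<noteq> 0} \<subseteq> cbox (- a) a"
    using bounded_subset_cbox_symmetric[OF assms(2)] by blast
  have "integrable lborel (\<lambda>x. indicator (cbox (- a) a) x *\<^sub>R f x)"
    by (intro borel_integrable_compact continuous_on_subset[OF assms(1)]) auto
  moreover have "(\<lambda>x. indicator (cbox (- a) a) x *\<^sub>R f x) = f"
    using a by (auto simp: fun_eq_iff indicator_def)
  ultimately show ?thesis
    by (metis integrable_completion borel_measurable_integrable)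
qed

lemma continuous_bounded_support_bounded:
  fixes f :: "'a::euclidean_space \<Rightarrow> real"
  assumes "continuous_on UNIV f" "bounded {x. f x \<noteq> 0}"
  obtains K where "K > 0" "\<And>x. \<bar>f x\<bar> \<le> K"
proof -
  obtain a where a: "{x. f x \<noteq> 0} \<subseteq> cbox (- a) a"
    using bounded_subset_cbox_symmetric[OF assms(2)] by blast
  have "bounded (f ` cbox (- a) a)"
    by (intro compact_imp_bounded compact_continuous_image continuous_on_subset[OF assms(1)]) auto
  then obtain K where K: "\<And>x. x \<in> cbox (- a) a \<Longrightarrow> \<bar>f x\<bar> \<le> K"
    unfolding bounded_iff by fastforce
  have "\<bar>f x\<bar> \<le> max K 1" for x
    using K[of x] a by (cases "f x = 0") (auto simp: max.coboundedI1)
  then show ?thesis by (intro that[of "max K 1"]) auto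
qed

lemma partial_eq_0_outside_support:
  assumes "open A" "x \<in> A" "\<And>y. y \<in> A \<Longrightarrow> f y = 0"
  shows "partial i f x = 0"
proof -
  have "(f has_derivative (\<lambda>_. 0)) (at x)"
    by (rule has_derivative_transform_within_open[OF has_derivative_const[of 0] assms(1,2)])
      (use assms(3) in auto)
  from partial_eqI[OF this] show ?thesis by simp
qed

lemma partial_support: "{x. partial i f x \<noteq> 0} \<subseteq> closure {x. f x \<noteq> 0}"
proof (rule subsetI, rule ccontr)
  fix x assume "x \<in> {x. partial i f x \<noteq> 0}" and x: "x \<notin> closure {x. f x \<noteq> 0}"
  moreover have "partial i f x = 0"
    by (rule partial_eq_0_outside_support[of "- closure {x. f x \<noteq> 0}"])
      (use x closure_subset[of "{x. f x \<noteq> 0}"] in auto)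
  ultimately show False by simp
qed

lemma bounded_partial_support:
  "bounded {x. f x \<noteq> 0} \<Longrightarrow> bounded {x. partial i f x \<noteq> 0}"
  using bounded_subset[OF bounded_closure partial_support] by blast

lemma integral_lborel_translate:
  fixes f :: "'a::euclidean_space \<Rightarrow> real"
  assumes "f \<in> borel_measurable borel"
  shows "(\<integral>x. f (c + x) \<partial>lborel) = (\<integral>x. f x \<partial>lborel)"
proof -
  have "(\<integral>x. f x \<partial>distr lborel borel ((+) c)) = (\<integral>x. f (c + x) \<partial>lborel)"
    using assms by (intro integral_distr) auto
  then show ?thesis by (simp add: lborel_distr_plus)
qed

lemma line_has_derivative:
  assumes "f differentiable (at (t *\<^sub>R axis i 1 + x))"
  shows "((\<lambda>t. f (t *\<^sub>R axis i 1 + x)) has_real_derivative partial i f (t *\<^sub>R axis i 1 + x)) (at t)"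
proof -
  let ?D = "frechet_derivative f (at (t *\<^sub>R axis i 1 + x))"
  have D: "(f has_derivative ?D) (at (t *\<^sub>R axis i 1 + x))"
    using assms by (simp add: frechet_derivative_works)
  have "((\<lambda>t. f (t *\<^sub>R axis i 1 + x)) has_derivative (\<lambda>h. ?D (h *\<^sub>R axis i 1))) (at t)"
    by (rule has_derivative_compose[where g=f and f="\<lambda>t. t *\<^sub>R axis i 1 + x", OF _ D])
      (auto intro!: derivative_eq_intros)
  moreover have "?D (h *\<^sub>R axis i 1) = ?D (axis i 1) * h" for h
    using linear_frechet_derivative[OF assms] by (simp add: linear_scale)
  ultimately show ?thesis
    by (simp add: has_field_derivative_def partial_def)
qed

text \<open>
  The integrals of the difference quotients vanish by translation invariance of the Lebesgue
  measure, and the difference quotients converge dominatedly.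
\<close>

lemma integral_partial_eq_0:
  assumes f: "Ck (Suc 0) f" and bd: "bounded {x. f x \<noteq> 0}"
  shows "(\<integral>x. partial i f x \<partial>lebesgue) = 0"
proof -
  let ?e = "axis i 1 :: real^3"
  have diff: "f differentiable (at x)" for x
    using f by simp
  have cf: "continuous_on UNIV f" and cp: "continuous_on UNIV (partial i f)"
    using f Ck_imp_continuous[OF f] by auto
  have [measurable]: "f \<in> borel_measurable borel" "partial i f \<in> borel_measurable borel"
    using cf cp by (auto intro: borel_measurable_continuous_onI)
  obtain K where K: "K > 0" "\<And>x. \<bar>partial i f x\<bar> \<le> K"
    using continuous_bounded_support_bounded[OF cp bounded_partial_support[OF bd]] by blast
  obtain R where R: "\<And>x. f x \<noteq> 0 \<Longrightarrow> norm x \<le> R"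
    using bd unfolding bounded_iff by auto
  define h where "h n = inverse (real (Suc n))" for n
  have h: "h n > 0" "h n \<le> 1" for n
    by (auto simp: h_def field_simps)
  define q where "q n x = (f (h n *\<^sub>R ?e + x) - f x) / h n" for n x
  define w where "w x = K * indicator (cball 0 (R + 1)) x" for x :: "real^3"
  have "(\<lambda>n. \<integral>x. q n x \<partial>lborel) \<longlonglongrightarrow> (\<integral>x. partial i f x \<partial>lborel)"
  proof (rule integral_dominated_convergence[where w=w])
    show "integrable lborel w"
      unfolding w_def by (intro integrable_mult_right integrable_real_indicator)
        (auto intro: emeasure_bounded_finite[unfolded infinity_ennreal_def])
    show "AE x in lborel. (\<lambda>n. q n x) \<longlonglongrightarrow> partial i f x"
    proof (rule AE_I2)
      fix x
      have "((\<lambda>t. f (t *\<^sub>R ?e + x)) has_real_derivative partial i f x) (at 0)"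
        using line_has_derivative[of f 0 i x] diff by simp
      then have "((\<lambda>t. (f (t *\<^sub>R ?e + x) - f x) / t) \<longlongrightarrow> partial i f x) (at 0)"
        by (simp add: has_field_derivative_iff)
      moreover have "filterlim h (at 0) sequentially"
        unfolding filterlim_at using h LIMSEQ_inverse_real_of_nat
        by (auto simp: h_def[abs_def])
      ultimately show "(\<lambda>n. q n x) \<longlonglongrightarrow> partial i f x"
        unfolding q_def by (rule filterlim_compose)
    qed
    show "AE x in lborel. norm (q n x) \<le> w x" for n
    proof (rule AE_I2)
      fix x
      have "\<exists>z>0. z < h n \<and> f (h n *\<^sub>R ?e + x) - f (0 *\<^sub>R ?e + x) =
          (h n - 0) * partial i f (z *\<^sub>R ?e + x)"
        by (rule MVT2[OF h(1)]) (use line_has_derivative diff in blast)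
      then have 1: "\<bar>q n x\<bar> \<le> K"
        using K h(1)[of n] by (auto simp: q_def abs_mult)
      have 2: "q n x = 0" if "norm x > R + 1"
      proof -
        have "norm (h n *\<^sub>R ?e + x) \<ge> norm x - norm (h n *\<^sub>R ?e)"
          by (metis add.commute norm_diff_ineq)
        moreover have "norm (h n *\<^sub>R ?e) \<le> 1"
          using h[of n] by (simp add: norm_axis_1)
        ultimately have "f (h n *\<^sub>R ?e + x) = 0" "f x = 0"
          using that R[of x] R[of "h n *\<^sub>R ?e + x"] by fastforce+
        then show ?thesis by (simp add: q_def)
      qed
      show "norm (q n x) \<le> w x"
        using 1 2 by (cases "norm x \<le> R + 1") (auto simp: w_def)
    qed
  qed (auto simp: q_def)
  moreover have "(\<integral>x. q n x \<partial>lborel) = 0" for n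
  proof -
    have intf: "integrable lborel f"
      using integrable_continuous_bounded_support[OF cf bd] by (simp add: integrable_completion)
    then have "integrable (distr lborel borel ((+) (h n *\<^sub>R ?e))) f"
      by (simp add: lborel_distr_plus)
    then have "integrable lborel (\<lambda>x. f (h n *\<^sub>R ?e + x))"
      by (subst (asm) integrable_distr_eq) auto
    then show ?thesis
      using intf unfolding q_def
      by (simp add: integral_lborel_translate)
  qed
  ultimately have "(\<integral>x. partial i f x \<partial>lborel) = 0"
    by (simp add: LIMSEQ_const_iff)
  then show ?thesis
    by (simp add: integral_completion)
qed

lemma integral_by_parts:
  assumes f: "Ck (Suc 0) f" and g: "Ck (Suc 0) g" and bd: "bounded {x. f x \<noteq> 0}"
  shows "(\<integral>x. f x * partial i g x \<partial>lebesgue) = - (\<integral>x. partial i f x * g x \<partial>lebesgue)"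
proof -
  have bd': "bounded {x. f x * h x \<noteq> 0}" "bounded {x. partial i f x * h x \<noteq> 0}" for h
    by (auto intro: bounded_subset[OF bd] bounded_subset[OF bounded_partial_support[OF bd, of i]])
  have c: "continuous_on UNIV f" "continuous_on UNIV g"
    "continuous_on UNIV (partial i f)" "continuous_on UNIV (partial i g)"
    using f g Ck_imp_continuous[OF f] Ck_imp_continuous[OF g] by auto
  have int: "integrable lebesgue (\<lambda>x. f x * partial i g x)"
    "integrable lebesgue (\<lambda>x. partial i f x * g x)"
    by (intro integrable_continuous_bounded_support bd' continuous_intros c)+
  have "0 = (\<integral>x. partial i (\<lambda>x. f x * g x) x \<partial>lebesgue)"
    by (rule integral_partial_eq_0[symmetric]) (intro Ck_mult f g bd')+
  also have "\<dots> = (\<integral>x. f x * partial i g x + partial i f x * g x \<partial>lebesgue)"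
    using f g by (intro Bochner_Integration.integral_cong refl partial_mult) auto
  also have "\<dots> = (\<integral>x. f x * partial i g x \<partial>lebesgue) + (\<integral>x. partial i f x * g x \<partial>lebesgue)"
    using int by simp
  finally show ?thesis by simp
qed

text \<open>
  The identity behind the Poincare inequality: the integral of \<open>\<partial>\<^sub>i (x\<^sub>i f\<^sup>2)\<close> vanishes.
\<close>

lemma integral_square_eq_partial:
  assumes f: "Ck (Suc 0) f" and bd: "bounded {x. f x \<noteq> 0}"
  shows "(\<integral>x. (f x)\<^sup>2 \<partial>lebesgue) = - 2 * (\<integral>x. x $ i * f x * partial i f x \<partial>lebesgue)"
proof -
  have c: "continuous_on UNIV f" "continuous_on UNIV (partial i f)"
    using f Ck_imp_continuous[OF f] by auto
  have c1: "continuous_on UNIV (\<lambda>x::real^3. x $ i)"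
    by (intro continuous_intros)
  have bd1: "bounded {x. f x * h x \<noteq> 0}" for h
    by (rule bounded_subset[OF bd]) auto
  have xf: "Ck (Suc 0) (\<lambda>x. x $ i * f x)"
    by (intro Ck_mult Ck_coordinate f)
  have bd2: "bounded {x. x $ i * f x \<noteq> 0}"
    by (rule bounded_subset[OF bd]) auto
  have p: "partial i (\<lambda>x. x $ i * f x) x = x $ i * partial i f x + f x" for x
    using f Ck_coordinate[of "Suc 0" i] by (simp add: partial_mult partial_coordinate)
  have int: "integrable lebesgue (\<lambda>x. f x * f x)" "integrable lebesgue (\<lambda>x. f x * (x $ i * partial i f x))"
    by (intro integrable_continuous_bounded_support bd1 continuous_intros c c1)+
  have "(\<integral>x. x $ i * f x * partial i f x \<partial>lebesgue) =
      - (\<integral>x. (x $ i * partial i f x + f x) * f x \<partial>lebesgue)"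
    using integral_by_parts[OF xf f bd2, of i] by (simp add: p)
  also have "(\<integral>x. (x $ i * partial i f x + f x) * f x \<partial>lebesgue) =
     (\<integral>x. f x * (x $ i * partial i f x) + f x * f x \<partial>lebesgue)"
    by (simp add: algebra_simps)
  also have "\<dots> = (\<integral>x. f x * (x $ i * partial i f x) \<partial>lebesgue) + (\<integral>x. f x * f x \<partial>lebesgue)"
    using int by simp
  finally show ?thesis
    by (simp add: algebra_simps power2_eq_square)
qed

section \<open>The fundamental lemma of the calculus of variations\<close>

lemma test_functionsD:
  assumes "\<phi> \<in> test_functions \<Omega>"
  shows test_functions_Ck: "Ck k \<phi>"
    and test_functions_bounded_support: "bounded {x. \<phi> x \<noteq> 0}"
    and test_functions_eq_0: "x \<notin> \<Omega> \<Longrightarrow> \<phi> x = 0"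
    and test_functions_continuous: "continuous_on UNIV \<phi>"
  using assms closure_subset[of "{x. \<phi> x \<noteq> 0}"] Ck_imp_continuous[of 0 \<phi>]
  by (auto simp: test_functions_def dest!: compact_imp_bounded intro: bounded_subset)

lemma test_functionsI:
  assumes "\<And>k. Ck k \<phi>" "{x. \<phi> x \<noteq> 0} \<subseteq> K" "compact K" "K \<subseteq> \<Omega>"
  shows "\<phi> \<in> test_functions \<Omega>"
proof -
  have "closure {x. \<phi> x \<noteq> 0} \<subseteq> K"
    using assms by (intro closure_minimal compact_imp_closed)
  then show ?thesis
    using assms by (auto simp: test_functions_def compact_eq_bounded_closed intro: bounded_subset)
qed

lemma test_functions_support:
  assumes "\<phi> \<in> test_functions \<Omega>"
  shows "compact (closure {x. \<phi> x \<noteq> 0})" "closure {x. \<phi> x \<noteq> 0} \<subseteq> \<Omega>"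
    "{x. \<phi> x \<noteq> 0} \<subseteq> closure {x. \<phi> x \<noteq> 0}"
  using assms by (simp_all add: test_functions_def closure_subset)

lemma test_functions_add:
  assumes "\<phi> \<in> test_functions \<Omega>" "\<psi> \<in> test_functions \<Omega>"
  shows "(\<lambda>x. \<phi> x + \<psi> x) \<in> test_functions \<Omega>"
proof (rule test_functionsI[of _ "closure {x. \<phi> x \<noteq> 0} \<union> closure {x. \<psi> x \<noteq> 0}"])
  show "{x. \<phi> x + \<psi> x \<noteq> 0} \<subseteq> closure {x. \<phi> x \<noteq> 0} \<union> closure {x. \<psi> x \<noteq> 0}"
    using closure_subset[of "{x. \<phi> x \<noteq> 0}"] closure_subset[of "{x. \<psi> x \<noteq> 0}"] by fastforce
qed (use assms test_functions_support in \<open>auto intro: Ck_add test_functions_Ck\<close>)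

lemma test_functions_cmult:
  assumes "\<phi> \<in> test_functions \<Omega>"
  shows "(\<lambda>x. c * \<phi> x) \<in> test_functions \<Omega>"
proof (rule test_functionsI[of _ "closure {x. \<phi> x \<noteq> 0}"])
  show "{x. c * \<phi> x \<noteq> 0} \<subseteq> closure {x. \<phi> x \<noteq> 0}"
    using closure_subset[of "{x. \<phi> x \<noteq> 0}"] by auto
qed (use assms test_functions_support in \<open>auto intro: Ck_mult test_functions_Ck\<close>)

lemma test_functions_zero: "(\<lambda>x. 0) \<in> test_functions \<Omega>"
  by (rule test_functionsI[of _ "{}"]) auto

lemma test_functions_partial:
  assumes "\<phi> \<in> test_functions \<Omega>"
  shows "partial i \<phi> \<in> test_functions \<Omega>"
  using test_functions_support[OF assms] partial_support[of i \<phi>]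
  by (intro test_functionsI[of _ "closure {x. \<phi> x \<noteq> 0}"])
    (auto intro!: Ck_partial test_functions_Ck[OF assms] simp del: Ck.simps)

text \<open>
  Let \<open>h\<close> be the product of the functions \<open>exp (- 1 / (x\<^sub>i - a\<^sub>i))\<close> and \<open>exp (- 1 / (b\<^sub>i - x\<^sub>i))\<close> on
  the open box between \<open>a\<close> and \<open>b\<close>, and \<open>0\<close> outside of it.  The roots of \<open>h\<close> of order \<open>n + 1\<close> are
  smooth, bounded by \<open>1\<close>, and tend to the indicator function of the box.
\<close>

definition box_bump :: "nat \<Rightarrow> real^3 \<Rightarrow> real^3 \<Rightarrow> scalar_field" where
  "box_bump n a b x =
     (\<Prod>i\<in>UNIV. flat_exp (inverse (Suc n)) 0 (x $ i - a $ i) *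
       flat_exp (inverse (Suc n)) 0 (b $ i - x $ i))"

lemma flat_exp_0_bounds: "c > 0 \<Longrightarrow> 0 \<le> flat_exp c 0 t" "c > 0 \<Longrightarrow> flat_exp c 0 t \<le> 1"
  by (auto simp: flat_exp_def)

lemma box_bump_bounds: "0 \<le> box_bump n a b x" "box_bump n a b x \<le> 1"
  unfolding box_bump_def
  by (intro prod_nonneg prod_le_1 conjI mult_nonneg_nonneg mult_le_one flat_exp_0_bounds; simp)+

lemma box_bump_tendsto: "(\<lambda>n. box_bump n a b x) \<longlonglongrightarrow> indicator (box a b) x"
proof -
  have 1: "(\<lambda>n. flat_exp (inverse (Suc n)) 0 t) \<longlonglongrightarrow> of_bool (t > 0)" for t
  proof -
    have "(\<lambda>n. exp (- (inverse (real (Suc n)) * inverse t))) \<longlonglongrightarrow> exp (- (0 * inverse t))"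
      by (intro tendsto_intros LIMSEQ_inverse_real_of_nat)
    then show ?thesis
      by (cases "t > 0") (auto simp: flat_exp_def)
  qed
  have "(\<lambda>n. box_bump n a b x) \<longlonglongrightarrow>
      (\<Prod>i\<in>UNIV. of_bool (x $ i - a $ i > 0) * of_bool (b $ i - x $ i > 0))"
    unfolding box_bump_def by (intro tendsto_prod tendsto_mult 1)
  also have "(\<Prod>i\<in>UNIV. of_bool (x $ i - a $ i > 0) * of_bool (b $ i - x $ i > 0)) =
      (indicator (box a b) x :: real)"
    by (auto simp: indicator_def mem_box_cart simp flip: of_bool_conj)
  finally show ?thesis .
qed

lemma box_bump_test_function:
  assumes "cbox a b \<subseteq> \<Omega>"
  shows "box_bump n a b \<in> test_functions \<Omega>"
proof (rule test_functionsI[OF _ _ compact_cbox assms])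
  have "Ck k (\<lambda>x. \<Prod>i\<in>UNIV. flat_exp (inverse (Suc n)) 0 (1 * x $ i + (- a $ i)) *
       flat_exp (inverse (Suc n)) 0 ((-1) * x $ i + b $ i))" for k
    by (intro Ck_prod Ck_mult Ck_flat_exp_affine) auto
  then show "Ck k (box_bump n a b)" for k
    by (simp add: box_bump_def[abs_def])
  show "{x. box_bump n a b x \<noteq> 0} \<subseteq> cbox a b"
    by (auto simp: box_bump_def mem_box_cart flat_exp_def split: if_splits) 
      (metis less_eq_real_def)+
qed

lemma sigma_finite_measure_lebesgue: "sigma_finite_measure lebesgue"
proof
  obtain A :: "'a set set" where A: "countable A" "A \<subseteq> sets lborel" "\<Union>A = space lborel"
    "\<forall>a\<in>A. emeasure lborel a \<noteq> \<infinity>"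
    using lborel.sigma_finite_countable by blast
  then show "\<exists>A :: 'a set set. countable A \<and> A \<subseteq> sets lebesgue \<and> \<Union>A = space lebesgue \<and>
      (\<forall>a\<in>A. emeasure lebesgue a \<noteq> \<infinity>)"
    by (intro exI[of _ A]) auto
qed

text \<open>
  Open boxes form a \<open>\<inter>\<close>-stable generator of the Borel sets, so that Dynkin's theorem applies.
\<close>

lemma AE_eq_0_if_integral_boxes_eq_0:
  fixes f :: "'a::euclidean_space \<Rightarrow> real"
  assumes f: "integrable lebesgue f"
    and box: "\<And>a b. (LINT x:box a b|lebesgue. f x) = 0"
    and UNIV: "(LINT x|lebesgue. f x) = 0"
  shows "AE x in lebesgue. f x = 0"
proof (rule sigma_finite_measure.density_zero[OF sigma_finite_measure_lebesgue f])
  have si: "set_integrable lebesgue A f" if "A \<in> sets lebesgue" for A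
    using integrable_mult_indicator[OF that f] by (simp add: set_integrable_def)
  have borel: "(LINT x:A|lebesgue. f x) = 0" if "A \<in> sets borel" for A
  proof -
    have "Int_stable (range (\<lambda>(a, b). box a b :: 'a set))"
      by (auto simp: Int_stable_def box_Int_box)
    moreover have "range (\<lambda>(a, b). box a b :: 'a set) \<subseteq> Pow UNIV" by simp
    moreover have "A \<in> sigma_sets UNIV (range (\<lambda>(a, b). box a b :: 'a set))"
      using that by (simp add: borel_eq_box)
    ultimately show ?thesis
    proof (induction rule: sigma_sets_induct_disjoint)
      case (compl A)
      then have "A \<in> sets borel" by (simp add: borel_eq_box)
      then have A: "A \<in> sets lebesgue" by simp
      have "(LINT x:A \<union> (UNIV - A)|lebesgue. f x) =
          (LINT x:A|lebesgue. f x) + (LINT x:UNIV - A|lebesgue. f x)"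
        using A by (intro set_integral_Un si) auto
      then show ?case using UNIV compl by (simp add: set_lebesgue_integral_def)
    next
      case (union A)
      then have "A i \<in> sets borel" for i by (auto simp: borel_eq_box)
      then have A: "A i \<in> sets lebesgue" for i by simp
      have "(LINT x:(\<Union>i. A i)|lebesgue. f x) = (\<Sum>i. LINT x:A i|lebesgue. f x)"
        using A union(1) by (intro lebesgue_integral_countable_add si)
          (auto simp: disjoint_family_on_def)
      then show ?case using union by simp
    next
      case (basic A)
      then show ?case using box by auto
    next
      case empty
      show ?case by (simp add: set_lebesgue_integral_def)
    qed
  qed
  fix A :: "'a set" assume A: "A \<in> sets lebesgue"
  then obtain S N N' where *: "A = S \<union> N" "N \<subseteq> N'" "N' \<in> null_sets lborel" "S \<in> sets lborel"
    by (rule sets_completionE)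
  have "N' \<in> null_sets lebesgue"
    using * by (simp add: null_sets_completionI)
  then have "AE x in lebesgue. x \<notin> N'"
    by (rule AE_not_in)
  then have "(LINT x:A|lebesgue. f x) = (LINT x:S|lebesgue. f x)"
    unfolding set_lebesgue_integral_def
  proof (intro integral_cong_AE)
    have S: "S \<in> sets lebesgue" using * by auto
    show "(\<lambda>x. indicator A x *\<^sub>R f x) \<in> borel_measurable lebesgue"
      "(\<lambda>x. indicator S x *\<^sub>R f x) \<in> borel_measurable lebesgue"
      using si[OF A] si[OF S] by (auto simp: set_integrable_def)
    assume "AE x in lebesgue. x \<notin> N'"
    then show "AE x in lebesgue. indicator A x *\<^sub>R f x = indicator S x *\<^sub>R f x"
      by eventually_elim (use * in \<open>auto simp: indicator_def\<close>)
  qed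
  then show "(LINT x:A|lebesgue. f x) = 0"
    using borel[of S] * by simp
qed

theorem fundamental_lemma_calculus_of_variations:
  assumes \<Omega>: "open \<Omega>"
    and f: "integrable (lebesgue_on \<Omega>) f"
    and test: "\<And>\<phi>. \<phi> \<in> test_functions \<Omega> \<Longrightarrow> (\<integral>x. f x * \<phi> x \<partial>lebesgue_on \<Omega>) = 0"
  shows "AE x in lebesgue_on \<Omega>. f x = 0"
proof -
  have leb: "\<Omega> \<in> sets lebesgue" using \<Omega> by (simp add: borel_open)
  define f0 where "f0 x = (if x \<in> \<Omega> then f x else 0)" for x
  have f0: "integrable lebesgue f0"
    unfolding f0_def[abs_def] using f leb by (simp add: Lebesgue_Measure.integrable_restrict_UNIV)
  \<comment> \<open>The smooth approximations of the indicator function of the box are test functions.\<close>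
  have 1: "(LINT x:box a b|lebesgue. f0 x) = 0" if ab: "cbox a b \<subseteq> \<Omega>" for a b
  proof -
    have "(\<lambda>n. \<integral>x. f0 x * box_bump n a b x \<partial>lebesgue) \<longlonglongrightarrow>
        (\<integral>x. f0 x * indicator (box a b) x \<partial>lebesgue)"
    proof (rule integral_dominated_convergence[where w="\<lambda>x. \<bar>f0 x\<bar>"])
      have "box_bump n a b \<in> borel_measurable borel" for n
        using test_functions_continuous[OF box_bump_test_function[OF ab]]
        by (rule borel_measurable_continuous_onI)
      then show "(\<lambda>x. f0 x * box_bump n a b x) \<in> borel_measurable lebesgue" for n
        by (intro borel_measurable_times borel_measurable_integrable[OF f0])
          (simp add: measurable_completion)
      show "AE x in lebesgue. norm (f0 x * box_bump n a b x) \<le> \<bar>f0 x\<bar>" for n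
        using box_bump_bounds[of n a b] by (auto simp: abs_mult intro!: mult_left_le)
      show "AE x in lebesgue. (\<lambda>n. f0 x * box_bump n a b x) \<longlonglongrightarrow> f0 x * indicator (box a b) x"
        by (auto intro!: tendsto_mult box_bump_tendsto)
      show "(\<lambda>x. f0 x * indicator (box a b) x) \<in> borel_measurable lebesgue"
        by (intro borel_measurable_times borel_measurable_integrable[OF f0]
            borel_measurable_indicator) simp
    qed (use f0 in auto)
    moreover have "(\<integral>x. f0 x * box_bump n a b x \<partial>lebesgue) = 0" for n
    proof -
      have "(\<integral>x. f0 x * box_bump n a b x \<partial>lebesgue) =
          (\<integral>x. (if x \<in> \<Omega> then f x * box_bump n a b x else 0) \<partial>lebesgue)"
        by (intro Bochner_Integration.integral_cong) (auto simp: f0_def)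
      also have "\<dots> = (\<integral>x. f x * box_bump n a b x \<partial>lebesgue_on \<Omega>)"
        by (rule Lebesgue_Measure.integral_restrict_UNIV[OF leb])
      finally show ?thesis using test[OF box_bump_test_function[OF ab]] by simp
    qed
    ultimately show ?thesis
      by (simp add: LIMSEQ_const_iff set_lebesgue_integral_def mult.commute)
  qed
  have 2: "AE x in lebesgue. x \<in> cbox a b \<longrightarrow> f x = 0" if ab: "cbox a b \<subseteq> \<Omega>" for a b
  proof -
    \<comment> \<open>After restriction to the box every box may be tested, also one that leaves \<open>\<Omega>\<close>.\<close>
    define g where "g x = indicator (box a b) x *\<^sub>R f0 x" for x
    have g: "(LINT x:box c d|lebesgue. g x) = 0" for c d
    proof -
      obtain e h where eh: "box a b \<inter> box c d = box e h"
        by (simp add: box_Int_box)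
      have "(LINT x:box c d|lebesgue. g x) = (LINT x:box e h|lebesgue. f0 x)"
        unfolding eh[symmetric] set_lebesgue_integral_def g_def
        by (intro Bochner_Integration.integral_cong) (auto simp: indicator_def)
      also have "\<dots> = 0"
      proof (cases "box e h = {}")
        case False
        then have "cbox e h = closure (box e h)"
          by (simp add: closure_box)
        also have "\<dots> \<subseteq> closure (box a b)"
          using eh by (intro closure_mono) auto
        also have "\<dots> \<subseteq> cbox a b"
          by (intro closure_minimal box_subset_cbox) auto
        finally show ?thesis using ab by (intro 1) auto
      qed (simp add: set_lebesgue_integral_def)
      finally show ?thesis .
    qed
    have "AE x in lebesgue. g x = 0"
    proof (rule AE_eq_0_if_integral_boxes_eq_0[OF _ g])
      show "integrable lebesgue g"
        unfolding g_def using f0 by (intro integrable_mult_indicator) auto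
      show "(\<integral>x. g x \<partial>lebesgue) = 0"
        using 1[OF ab] by (simp add: g_def set_lebesgue_integral_def)
    qed
    moreover have "AE x in lebesgue. x \<notin> cbox a b - box a b"
      using negligible_frontier_interval[of a b] by (intro AE_not_in) (simp add: negligible_iff_null_sets)
    ultimately show ?thesis
      by eventually_elim (use ab in \<open>auto simp: g_def f0_def\<close>)
  qed
  obtain \<D> where \<D>: "countable \<D>" "\<D> \<subseteq> Pow \<Omega>" "\<And>X. X \<in> \<D> \<Longrightarrow> \<exists>a b. X = cbox a b" "\<Union>\<D> = \<Omega>"
    using open_countable_Union_open_cbox[OF \<Omega>] by metis
  have "AE x in lebesgue. \<forall>X\<in>\<D>. x \<in> X \<longrightarrow> f x = 0"
  proof (subst AE_ball_countable[OF \<D>(1)], rule ballI)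
    fix X assume X: "X \<in> \<D>"
    then obtain a b where "X = cbox a b" using \<D>(3) by blast
    with 2[of a b] X \<D>(2) show "AE x in lebesgue. x \<in> X \<longrightarrow> f x = 0" by blast
  qed
  then have "AE x in lebesgue. x \<in> \<Omega> \<longrightarrow> f x = 0"
    by eventually_elim (use \<D>(4) in blast)
  then show ?thesis
    using leb by (simp add: AE_restrict_space_iff)
qed

section \<open>The Hilbert space of square integrable fields\<close>

text \<open>A nonnegative quadratic polynomial has nonpositive discriminant.\<close>

lemma discriminant_le:
  fixes A B C :: real
  assumes "\<And>t. 0 \<le> A + 2 * t * B + t\<^sup>2 * C"
  shows "B\<^sup>2 \<le> A * C"
proof (cases "C = 0")
  case True
  have "B = 0"
  proof (rule ccontr)
    assume "B \<noteq> 0"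
    then show False
      using assms[of "- (A + 1) / (2 * B)"] True by (simp add: field_simps)
  qed
  then show ?thesis using True by simp
next
  case False
  have "C \<ge> 0"
  proof (rule ccontr)
    assume C: "\<not> C \<ge> 0"
    define t where "t = max 1 ((\<bar>A\<bar> + 2 * \<bar>B\<bar> + 1) / - C)"
    have t: "t \<ge> 1" "t * - C \<ge> \<bar>A\<bar> + 2 * \<bar>B\<bar> + 1"
      using C by (auto simp: t_def field_simps max_def)
    have "t * (\<bar>A\<bar> + 2 * \<bar>B\<bar> + 1) \<le> t * (t * - C)"
      using t by (intro mult_left_mono) auto
    moreover have "A \<le> t * \<bar>A\<bar>"
      using t mult_right_mono[of 1 t "\<bar>A\<bar>"] by auto
    moreover have "t * B \<le> t * \<bar>B\<bar>"
      using t by (intro mult_left_mono) auto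
    moreover have "t * (\<bar>A\<bar> + 2 * \<bar>B\<bar> + 1) = t * \<bar>A\<bar> + 2 * (t * \<bar>B\<bar>) + t"
      by (simp add: algebra_simps)
    moreover have "t * (t * - C) = - (t\<^sup>2 * C)"
      by (simp add: power2_eq_square)
    moreover have "0 \<le> A + 2 * (t * B) + t\<^sup>2 * C"
      using assms[of t] by (simp add: mult.assoc)
    ultimately show False
      using t(1) by linarith
  qed
  with False have C: "C > 0" by simp
  have "0 \<le> A - B\<^sup>2 / C"
    using assms[of "- B / C"] C by (simp add: power2_eq_square field_simps)
  then show ?thesis using C by (simp add: field_simps)
qed

lemma le_if_square_le_mult:
  fixes x y :: real
  assumes "x * x \<le> x * y" "0 \<le> x" "0 \<le> y"
  shows "x \<le> y"
  using assms by (cases "x = 0") (auto intro: mult_left_le_imp_le)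

lemma L2_measurable: "f \<in> L2 \<Omega> \<Longrightarrow> f \<in> borel_measurable (lebesgue_on \<Omega>)"
  by (simp add: L2_def)

lemma L2_integrable_inner:
  assumes "f \<in> L2 \<Omega>" "g \<in> L2 \<Omega>"
  shows "integrable (lebesgue_on \<Omega>) (\<lambda>x. f x \<bullet> g x)"
proof (rule Bochner_Integration.integrable_bound)
  show "integrable (lebesgue_on \<Omega>) (\<lambda>x. (norm (f x))\<^sup>2 + (norm (g x))\<^sup>2)"
    using assms by (simp add: L2_def)
  have "\<bar>a \<bullet> b\<bar> \<le> (norm a)\<^sup>2 + (norm b)\<^sup>2" for a b :: 'a
  proof -
    have "\<bar>a \<bullet> b\<bar> \<le> norm a * norm b" by (rule Cauchy_Schwarz_ineq2)
    moreover have "2 * (norm a * norm b) \<le> (norm a)\<^sup>2 + (norm b)\<^sup>2"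
      using sum_squares_bound[of "norm a" "norm b"] by simp
    ultimately show ?thesis
      using mult_nonneg_nonneg[OF norm_ge_zero norm_ge_zero, of a b] by linarith
  qed
  then show "AE x in lebesgue_on \<Omega>. norm (f x \<bullet> g x) \<le> norm ((norm (f x))\<^sup>2 + (norm (g x))\<^sup>2)"
    by simp
qed (use assms in \<open>auto simp: L2_def\<close>)

lemma L2_iff_inner:
  "f \<in> L2 \<Omega> \<longleftrightarrow> f \<in> borel_measurable (lebesgue_on \<Omega>) \<and>
     integrable (lebesgue_on \<Omega>) (\<lambda>x. f x \<bullet> f x)"
  by (simp add: L2_def power2_norm_eq_inner)

lemma L2_scaleR: "f \<in> L2 \<Omega> \<Longrightarrow> (\<lambda>x. c *\<^sub>R f x) \<in> L2 \<Omega>"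
  by (auto simp: L2_iff_inner)

lemma L2_add:
  assumes "f \<in> L2 \<Omega>" "g \<in> L2 \<Omega>"
  shows "(\<lambda>x. f x + g x) \<in> L2 \<Omega>"
  using L2_integrable_inner[OF assms(1,1)] L2_integrable_inner[OF assms(1,2)]
    L2_integrable_inner[OF assms(2,1)] L2_integrable_inner[OF assms(2,2)] assms
  by (auto simp: L2_iff_inner inner_add)

lemma L2_diff:
  assumes "f \<in> L2 \<Omega>" "g \<in> L2 \<Omega>"
  shows "(\<lambda>x. f x - g x) \<in> L2 \<Omega>"
  using L2_add[OF assms(1) L2_scaleR[OF assms(2), of "-1"]] by simp

lemma L2_cmult: "f \<in> L2 \<Omega> \<Longrightarrow> (\<lambda>x. c * f x :: real) \<in> L2 \<Omega>"
  using L2_scaleR[of f \<Omega> c] by simp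

lemma L2_inner_add_left:
  assumes "f \<in> L2 \<Omega>" "g \<in> L2 \<Omega>" "h \<in> L2 \<Omega>"
  shows "L2_inner \<Omega> (\<lambda>x. f x + g x) h = L2_inner \<Omega> f h + L2_inner \<Omega> g h"
  using assms by (simp add: L2_inner_def inner_add_left L2_integrable_inner)

lemma L2_inner_scaleR_left: "L2_inner \<Omega> (\<lambda>x. c *\<^sub>R f x) h = c * L2_inner \<Omega> f h"
  by (simp add: L2_inner_def)

lemma L2_inner_commute: "L2_inner \<Omega> f g = L2_inner \<Omega> g f"
  by (simp add: L2_inner_def inner_commute)

lemma L2_inner_add_right:
  assumes "f \<in> L2 \<Omega>" "g \<in> L2 \<Omega>" "h \<in> L2 \<Omega>"
  shows "L2_inner \<Omega> h (\<lambda>x. f x + g x) = L2_inner \<Omega> h f + L2_inner \<Omega> h g"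
  using L2_inner_add_left[OF assms] by (simp add: L2_inner_commute)

lemma L2_inner_scaleR_right: "L2_inner \<Omega> h (\<lambda>x. c *\<^sub>R f x) = c * L2_inner \<Omega> h f"
  by (simp add: L2_inner_def)

lemma L2_inner_diff_left:
  assumes "f \<in> L2 \<Omega>" "g \<in> L2 \<Omega>" "h \<in> L2 \<Omega>"
  shows "L2_inner \<Omega> (\<lambda>x. f x - g x) h = L2_inner \<Omega> f h - L2_inner \<Omega> g h"
  using assms by (simp add: L2_inner_def inner_diff_left L2_integrable_inner)

lemma L2_inner_nonneg: "0 \<le> L2_inner \<Omega> f f"
  by (simp add: L2_inner_def)

lemma L2_norm_nonneg [simp]: "0 \<le> L2_norm \<Omega> f"
  by (simp add: L2_norm_def L2_inner_nonneg)

lemma L2_norm_square: "(L2_norm \<Omega> f)\<^sup>2 = L2_inner \<Omega> f f"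
  by (simp add: L2_norm_def L2_inner_nonneg)

lemma L2_inner_add_scaleR:
  assumes f: "f \<in> L2 \<Omega>" and g: "g \<in> L2 \<Omega>"
  shows "L2_inner \<Omega> (\<lambda>x. f x + t *\<^sub>R g x) (\<lambda>x. f x + t *\<^sub>R g x) =
    L2_inner \<Omega> f f + 2 * t * L2_inner \<Omega> f g + t\<^sup>2 * L2_inner \<Omega> g g"
proof -
  note tg = L2_scaleR[OF g, of t]
  have "L2_inner \<Omega> (\<lambda>x. f x + t *\<^sub>R g x) (\<lambda>x. f x + t *\<^sub>R g x) =
    (L2_inner \<Omega> f f + t * L2_inner \<Omega> f g) + t * (L2_inner \<Omega> g f + t * L2_inner \<Omega> g g)"
    using f g tg by (simp add: L2_inner_add_left L2_inner_add_right L2_add L2_inner_scaleR_left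
        L2_inner_scaleR_right)
  then show ?thesis
    by (simp add: L2_inner_commute[of \<Omega> g f] algebra_simps power2_eq_square)
qed

lemma L2_Cauchy_Schwarz:
  assumes "f \<in> L2 \<Omega>" "g \<in> L2 \<Omega>"
  shows "\<bar>L2_inner \<Omega> f g\<bar> \<le> L2_norm \<Omega> f * L2_norm \<Omega> g"
proof -
  have "(L2_inner \<Omega> f g)\<^sup>2 \<le> L2_inner \<Omega> f f * L2_inner \<Omega> g g"
    using L2_inner_nonneg[of \<Omega> "\<lambda>x. f x + t *\<^sub>R g x" for t] L2_inner_add_scaleR[OF assms]
    by (intro discriminant_le) simp
  then have "\<bar>L2_inner \<Omega> f g\<bar>\<^sup>2 \<le> (L2_norm \<Omega> f * L2_norm \<Omega> g)\<^sup>2"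
    by (simp add: power_mult_distrib L2_norm_square)
  then show ?thesis
    by (rule power2_le_imp_le) simp
qed

lemma L2_norm_triangle:
  assumes "f \<in> L2 \<Omega>" "g \<in> L2 \<Omega>"
  shows "L2_norm \<Omega> (\<lambda>x. f x + g x) \<le> L2_norm \<Omega> f + L2_norm \<Omega> g"
proof (rule power2_le_imp_le)
  have "(L2_norm \<Omega> (\<lambda>x. f x + g x))\<^sup>2 =
      (L2_norm \<Omega> f)\<^sup>2 + 2 * L2_inner \<Omega> f g + (L2_norm \<Omega> g)\<^sup>2"
    using L2_inner_add_scaleR[OF assms, of 1] by (simp add: L2_norm_square)
  also have "\<dots> \<le> (L2_norm \<Omega> f + L2_norm \<Omega> g)\<^sup>2"
    using L2_Cauchy_Schwarz[OF assms] by (simp add: power2_sum)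
  finally show "(L2_norm \<Omega> (\<lambda>x. f x + g x))\<^sup>2 \<le> (L2_norm \<Omega> f + L2_norm \<Omega> g)\<^sup>2" .
qed simp

lemma L2_norm_scaleR: "L2_norm \<Omega> (\<lambda>x. c *\<^sub>R f x) = \<bar>c\<bar> * L2_norm \<Omega> f"
proof -
  have "L2_inner \<Omega> (\<lambda>x. c *\<^sub>R f x) (\<lambda>x. c *\<^sub>R f x) = c\<^sup>2 * L2_inner \<Omega> f f"
    by (simp add: L2_inner_scaleR_left L2_inner_scaleR_right power2_eq_square)
  then show ?thesis by (simp add: L2_norm_def real_sqrt_mult)
qed

lemma L2_norm_minus_commute: "L2_norm \<Omega> (\<lambda>x. f x - g x) = L2_norm \<Omega> (\<lambda>x. g x - f x)"
  using L2_norm_scaleR[of \<Omega> "-1" "\<lambda>x. f x - g x"] by simp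

lemma L2_norm_triangle_diff:
  assumes "f \<in> L2 \<Omega>" "g \<in> L2 \<Omega>"
  shows "L2_norm \<Omega> (\<lambda>x. f x - g x) \<le> L2_norm \<Omega> f + L2_norm \<Omega> g"
  using L2_norm_triangle[OF assms(1) L2_scaleR[OF assms(2), of "-1"]] L2_norm_scaleR[of \<Omega> "-1" g]
  by simp

lemma L2_norm_triangle_sub:
  assumes "f \<in> L2 \<Omega>" "g \<in> L2 \<Omega>"
  shows "L2_norm \<Omega> f \<le> L2_norm \<Omega> (\<lambda>x. f x - g x) + L2_norm \<Omega> g"
  using L2_norm_triangle[OF L2_diff[OF assms] assms(2)] by simp

lemma L2_norm_eq_0_imp_ae_0:
  assumes "f \<in> L2 \<Omega>" "L2_norm \<Omega> f = 0"
  shows "ae_eq \<Omega> f (\<lambda>x. 0)"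
proof -
  have "AE x in lebesgue_on \<Omega>. f x \<bullet> f x = 0"
    using assms by (subst integral_nonneg_eq_0_iff_AE[symmetric])
      (auto simp: L2_iff_inner L2_norm_def L2_inner_def)
  then show ?thesis by (simp add: ae_eq_def)
qed

lemma ae_eq_refl [simp]: "ae_eq \<Omega> f f"
  by (simp add: ae_eq_def)

lemma ae_eq_sym: "ae_eq \<Omega> f g \<Longrightarrow> ae_eq \<Omega> g f"
  by (auto simp: ae_eq_def elim: AE_mp)

lemma borel_measurable_ae_eq:
  fixes f g :: "real^3 \<Rightarrow> 'b::euclidean_space"
  assumes \<Omega>: "\<Omega> \<in> sets lebesgue" and "ae_eq \<Omega> f g" "f \<in> borel_measurable (lebesgue_on \<Omega>)"
  shows "g \<in> borel_measurable (lebesgue_on \<Omega>)"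
proof -
  have "(\<lambda>x. if x \<in> \<Omega> then f x else 0) \<in> borel_measurable lebesgue"
    using assms by (simp add: borel_measurable_if)
  moreover have "AE x in lebesgue. (if x \<in> \<Omega> then f x else 0) = (if x \<in> \<Omega> then g x else 0)"
    using assms by (auto simp: ae_eq_def AE_restrict_space_iff elim: AE_mp)
  ultimately have "(\<lambda>x. if x \<in> \<Omega> then g x else 0) \<in> borel_measurable lebesgue"
    by (rule borel_measurable_AE)
  then show ?thesis by (rule borel_measurable_if_D)
qed

lemma L2_ae_eq:
  assumes \<Omega>: "\<Omega> \<in> sets lebesgue" and fg: "ae_eq \<Omega> f g" and f: "f \<in> L2 \<Omega>"
  shows "g \<in> L2 \<Omega>"
proof -
  have g: "g \<in> borel_measurable (lebesgue_on \<Omega>)"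
    using borel_measurable_ae_eq[OF \<Omega> fg] f by (simp add: L2_def)
  have "integrable (lebesgue_on \<Omega>) (\<lambda>x. (norm (g x))\<^sup>2)"
    by (rule integrable_cong_AE_imp[of _ "\<lambda>x. (norm (f x))\<^sup>2"])
      (use f g fg in \<open>auto simp: L2_def ae_eq_def elim: AE_mp\<close>)
  with g show ?thesis by (simp add: L2_def)
qed

lemma L2_inner_ae_eq:
  assumes "ae_eq \<Omega> f f'" "ae_eq \<Omega> g g'" "f \<in> L2 \<Omega>" "f' \<in> L2 \<Omega>" "g \<in> L2 \<Omega>" "g' \<in> L2 \<Omega>"
  shows "L2_inner \<Omega> f g = L2_inner \<Omega> f' g'"
  unfolding L2_inner_def
proof (rule integral_cong_AE)
  show "AE x in lebesgue_on \<Omega>. f x \<bullet> g x = f' x \<bullet> g' x"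
    using assms(1,2) unfolding ae_eq_def by eventually_elim simp
qed (use assms in \<open>auto simp: L2_def\<close>)

lemma L2_norm_ae_eq:
  assumes "ae_eq \<Omega> f g" "f \<in> L2 \<Omega>" "g \<in> L2 \<Omega>"
  shows "L2_norm \<Omega> f = L2_norm \<Omega> g"
  using L2_inner_ae_eq[OF assms(1,1)] assms by (simp add: L2_norm_def)

lemma L2_vec_nth:
  fixes g :: "real^3 \<Rightarrow> 'b::euclidean_space ^ 'n"
  assumes "g \<in> L2 \<Omega>"
  shows "(\<lambda>x. g x $ i) \<in> L2 \<Omega>"
proof -
  have "(\<lambda>y :: 'b^'n. y $ i) \<in> borel_measurable borel"
    by (intro borel_measurable_continuous_onI continuous_intros)
  then have m: "(\<lambda>x. g x $ i) \<in> borel_measurable (lebesgue_on \<Omega>)"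
    by (rule measurable_compose[OF L2_measurable[OF assms]])
  have "integrable (lebesgue_on \<Omega>) (\<lambda>x. (norm (g x $ i))\<^sup>2)"
    by (rule Bochner_Integration.integrable_bound[of _ "\<lambda>x. (norm (g x))\<^sup>2"])
      (use m assms in \<open>auto simp: L2_def intro!: power_mono Finite_Cartesian_Product.norm_nth_le\<close>)
  with m show ?thesis by (simp add: L2_def)
qed

lemma L2_bounded_continuous:
  fixes f :: "real^3 \<Rightarrow> 'b::euclidean_space"
  assumes \<Omega>: "\<Omega> \<in> sets lebesgue" and "continuous_on UNIV f" "bounded {x. f x \<noteq> 0}"
  shows "f \<in> L2 \<Omega>"
proof -
  have m: "f \<in> borel_measurable lebesgue"
    using borel_measurable_continuous_onI[OF assms(2)] by (simp add: measurable_completion)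
  have "integrable lebesgue (\<lambda>x. (norm (f x))\<^sup>2)"
    using assms by (intro integrable_continuous_bounded_support continuous_intros) auto
  then have "integrable lebesgue (\<lambda>x. indicator \<Omega> x *\<^sub>R (norm (f x))\<^sup>2)"
    by (rule integrable_mult_indicator[OF \<Omega>])
  with m \<Omega> show ?thesis
    by (auto simp: L2_def integrable_restrict_space measurable_restrict_space1)
qed

text \<open>
  On a set of finite measure a Cauchy sequence in \<open>L\<^sup>2\<close> is one in \<open>L\<^sup>1\<close>, hence has a subsequence
  converging almost everywhere; by Fatou's lemma its limit is the limit in \<open>L\<^sup>2\<close>.
\<close>

lemma L2_complete:
  fixes f :: "nat \<Rightarrow> real^3 \<Rightarrow> 'b::euclidean_space"
  assumes fin: "finite_measure (lebesgue_on \<Omega>)"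
    and f: "\<And>n. f n \<in> L2 \<Omega>"
    and Cauchy: "\<And>e. e > 0 \<Longrightarrow> \<exists>N. \<forall>i\<ge>N. \<forall>j\<ge>N. L2_norm \<Omega> (\<lambda>x. f i x - f j x) < e"
  obtains g where "g \<in> L2 \<Omega>" "(\<lambda>n. L2_norm \<Omega> (\<lambda>x. f n x - g x)) \<longlonglongrightarrow> 0"
proof -
  interpret finite_measure "lebesgue_on \<Omega>" by fact
  have one: "(\<lambda>x. 1 :: real) \<in> L2 \<Omega>" by (simp add: L2_def)
  have nrm: "(\<lambda>x. norm (h x)) \<in> L2 \<Omega>" "L2_norm \<Omega> (\<lambda>x. norm (h x)) = L2_norm \<Omega> h"
    if "h \<in> L2 \<Omega>" for h :: "real^3 \<Rightarrow> 'b"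
    using that by (auto simp: L2_def L2_norm_def L2_inner_def power2_norm_eq_inner
        simp flip: power2_eq_square)
  have int: "integrable (lebesgue_on \<Omega>) h" if "h \<in> L2 \<Omega>" for h :: "real^3 \<Rightarrow> 'b"
    using L2_integrable_inner[OF nrm(1)[OF that] one] that
    by (simp add: L2_def integrable_norm_iff)
  have [measurable]: "f n \<in> borel_measurable (lebesgue_on \<Omega>)" for n
    using f by (simp add: L2_def)
  have "\<exists>N. \<forall>i\<ge>N. \<forall>j\<ge>N. (\<integral>x. norm (f i x - f j x) \<partial>lebesgue_on \<Omega>) < e" if "e > 0" for e
  proof -
    define C where "C = L2_norm \<Omega> (\<lambda>x. 1 :: real) + 1"
    have C: "C > 0" by (simp add: C_def add_nonneg_pos)
    obtain N where N: "\<And>i j. i \<ge> N \<Longrightarrow> j \<ge> N \<Longrightarrow> L2_norm \<Omega> (\<lambda>x. f i x - f j x) < e / C"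
      using Cauchy[of "e / C"] \<open>e > 0\<close> C by auto
    have "(\<integral>x. norm (f i x - f j x) \<partial>lebesgue_on \<Omega>) < e" if "i \<ge> N" "j \<ge> N" for i j
    proof -
      have "(\<integral>x. norm (f i x - f j x) \<partial>lebesgue_on \<Omega>) \<le>
          L2_norm \<Omega> (\<lambda>x. f i x - f j x) * L2_norm \<Omega> (\<lambda>x. 1 :: real)"
        using L2_Cauchy_Schwarz[OF nrm(1)[OF L2_diff[OF f f]] one, of i j]
          nrm(2)[OF L2_diff[OF f f]] by (simp add: L2_inner_def)
      also have "\<dots> \<le> L2_norm \<Omega> (\<lambda>x. f i x - f j x) * C"
        by (intro mult_left_mono) (auto simp: C_def)
      also have "\<dots> < e"
        using N[OF that] C by (simp add: field_simps)
      finally show ?thesis .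
    qed
    then show ?thesis by blast
  qed
  then obtain r where r: "strict_mono r" "AE x in lebesgue_on \<Omega>. Cauchy (\<lambda>i. f (r i) x)"
    using cauchy_L1_AE_cauchy_subseq[of "lebesgue_on \<Omega>" f] int f by blast
  define g where "g x = lim (\<lambda>i. f (r i) x)" for x
  have [measurable]: "g \<in> borel_measurable (lebesgue_on \<Omega>)"
    unfolding g_def by measurable
  have lim: "AE x in lebesgue_on \<Omega>. (\<lambda>i. f (r i) x) \<longlonglongrightarrow> g x"
    using r(2) unfolding g_def
    by eventually_elim (simp add: Cauchy_convergent_iff convergent_LIMSEQ_iff)
  have Fatou: "(\<integral>\<^sup>+x. (norm (f n x - g x))\<^sup>2 \<partial>lebesgue_on \<Omega>) \<le> ennreal (e\<^sup>2)"
    if e: "e > 0" and N: "\<And>i. i \<ge> N \<Longrightarrow> L2_norm \<Omega> (\<lambda>x. f n x - f i x) < e" for n N e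
  proof -
    have "(\<integral>\<^sup>+x. (norm (f n x - g x))\<^sup>2 \<partial>lebesgue_on \<Omega>) =
        (\<integral>\<^sup>+x. liminf (\<lambda>i. ennreal ((norm (f n x - f (r i) x))\<^sup>2)) \<partial>lebesgue_on \<Omega>)"
    proof (rule nn_integral_cong_AE)
      show "AE x in lebesgue_on \<Omega>. ennreal ((norm (f n x - g x))\<^sup>2) =
          liminf (\<lambda>i. ennreal ((norm (f n x - f (r i) x))\<^sup>2))"
        using lim
      proof eventually_elim
        case (elim x)
        then have "(\<lambda>i. ennreal ((norm (f n x - f (r i) x))\<^sup>2)) \<longlonglongrightarrow> ennreal ((norm (f n x - g x))\<^sup>2)"
          by (intro tendsto_intros)
        then show ?case by (rule lim_imp_Liminf[OF trivial_limit_sequentially, symmetric])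
      qed
    qed
    also have "\<dots> \<le> liminf (\<lambda>i. \<integral>\<^sup>+x. (norm (f n x - f (r i) x))\<^sup>2 \<partial>lebesgue_on \<Omega>)"
      by (rule nn_integral_liminf) measurable
    also have "\<dots> \<le> limsup (\<lambda>i. \<integral>\<^sup>+x. (norm (f n x - f (r i) x))\<^sup>2 \<partial>lebesgue_on \<Omega>)"
      by (rule Liminf_le_Limsup) simp
    also have "\<dots> \<le> ennreal (e\<^sup>2)"
    proof (rule Limsup_bounded)
      have "(\<integral>\<^sup>+x. (norm (f n x - f (r i) x))\<^sup>2 \<partial>lebesgue_on \<Omega>) \<le> ennreal (e\<^sup>2)" if "i \<ge> N" for i
      proof -
        have "(\<integral>\<^sup>+x. (norm (f n x - f (r i) x))\<^sup>2 \<partial>lebesgue_on \<Omega>) =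
            ennreal ((L2_norm \<Omega> (\<lambda>x. f n x - f (r i) x))\<^sup>2)"
          using L2_diff[OF f f, of n "r i"] unfolding L2_norm_square L2_inner_def power2_norm_eq_inner
          by (intro nn_integral_eq_integral) (auto simp: L2_iff_inner)
        also have "\<dots> \<le> ennreal (e\<^sup>2)"
          using N[of "r i"] seq_suble[OF r(1), of i] that
          by (intro ennreal_leI power_mono) (auto simp: less_imp_le)
        finally show ?thesis .
      qed
      then show "\<forall>\<^sub>F i in sequentially.
          (\<integral>\<^sup>+x. (norm (f n x - f (r i) x))\<^sup>2 \<partial>lebesgue_on \<Omega>) \<le> ennreal (e\<^sup>2)"
        by (auto simp: eventually_sequentially)
    qed
    finally show ?thesis .
  qed
  have diff: "(\<lambda>x. f n x - g x) \<in> L2 \<Omega> \<and> L2_norm \<Omega> (\<lambda>x. f n x - g x) \<le> e"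
    if e: "e > 0" and N: "\<And>i. i \<ge> N \<Longrightarrow> L2_norm \<Omega> (\<lambda>x. f n x - f i x) < e" for n N e
  proof -
    have *: "(\<integral>\<^sup>+x. (norm (f n x - g x))\<^sup>2 \<partial>lebesgue_on \<Omega>) \<le> ennreal (e\<^sup>2)"
      using e N by (rule Fatou)
    have L: "(\<lambda>x. f n x - g x) \<in> L2 \<Omega>"
      unfolding L2_def using le_less_trans[OF * ennreal_less_top]
      by (auto intro!: integrableI_bounded)
    have "ennreal ((L2_norm \<Omega> (\<lambda>x. f n x - g x))\<^sup>2) =
        (\<integral>\<^sup>+x. (norm (f n x - g x))\<^sup>2 \<partial>lebesgue_on \<Omega>)"
      using L unfolding L2_norm_square L2_inner_def power2_norm_eq_inner
      by (intro nn_integral_eq_integral[symmetric]) (auto simp: L2_iff_inner)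
    then have "ennreal ((L2_norm \<Omega> (\<lambda>x. f n x - g x))\<^sup>2) \<le> ennreal (e\<^sup>2)"
      using * by (simp only:)
    then have "(L2_norm \<Omega> (\<lambda>x. f n x - g x))\<^sup>2 \<le> e\<^sup>2"
      by (subst (asm) ennreal_le_iff) simp_all
    with L e show ?thesis by (auto intro: power2_le_imp_le)
  qed
  have ev: "\<exists>N. \<forall>n\<ge>N. (\<lambda>x. f n x - g x) \<in> L2 \<Omega> \<and> L2_norm \<Omega> (\<lambda>x. f n x - g x) \<le> e"
    if e: "e > 0" for e
  proof -
    obtain N where "\<forall>i\<ge>N. \<forall>j\<ge>N. L2_norm \<Omega> (\<lambda>x. f i x - f j x) < e"
      using Cauchy[OF e] by blast
    then show ?thesis using diff[OF e] by blast
  qed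
  show ?thesis
  proof (rule that)
    obtain n where "(\<lambda>x. f n x - g x) \<in> L2 \<Omega>"
      using ev[of 1] by auto
    from L2_diff[OF f[of n] this] show "g \<in> L2 \<Omega>" by simp
    show "(\<lambda>n. L2_norm \<Omega> (\<lambda>x. f n x - g x)) \<longlonglongrightarrow> 0"
    proof (rule LIMSEQ_I)
      fix e :: real assume "e > 0"
      then show "\<exists>N. \<forall>n\<ge>N. norm (L2_norm \<Omega> (\<lambda>x. f n x - g x) - 0) < e"
        using ev[of "e / 2"] by fastforce
    qed
  qed
qed

lemma L2_norm_vec_nth_le:
  fixes g :: "real^3 \<Rightarrow> real^'n"
  assumes "g \<in> L2 \<Omega>"
  shows "L2_norm \<Omega> (\<lambda>x. g x $ i) \<le> L2_norm \<Omega> g"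
proof -
  have "L2_inner \<Omega> (\<lambda>x. g x $ i) (\<lambda>x. g x $ i) \<le> L2_inner \<Omega> g g"
    unfolding L2_inner_def
  proof (rule integral_mono)
    fix x
    have "\<bar>g x $ i\<bar>\<^sup>2 \<le> (norm (g x))\<^sup>2"
      by (intro power_mono component_le_norm_cart) simp
    then show "g x $ i \<bullet> g x $ i \<le> g x \<bullet> g x"
      unfolding power2_norm_eq_inner by (simp add: power2_eq_square)
  qed (intro L2_integrable_inner L2_vec_nth assms)+
  then show ?thesis by (simp add: L2_norm_def)
qed

lemma L2_inner_tendsto:
  assumes "\<And>n. f n \<in> L2 \<Omega>" "g \<in> L2 \<Omega>" "h \<in> L2 \<Omega>"
    and "(\<lambda>n. L2_norm \<Omega> (\<lambda>x. f n x - g x)) \<longlonglongrightarrow> 0"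
  shows "(\<lambda>n. L2_inner \<Omega> (f n) h) \<longlonglongrightarrow> L2_inner \<Omega> g h"
proof (rule LIM_zero_cancel, rule Lim_null_comparison)
  have "\<bar>L2_inner \<Omega> (f n) h - L2_inner \<Omega> g h\<bar> \<le> L2_norm \<Omega> (\<lambda>x. f n x - g x) * L2_norm \<Omega> h" for n
    using L2_Cauchy_Schwarz[OF L2_diff[OF assms(1,2)] assms(3), of n] assms
    by (simp add: L2_inner_diff_left)
  then show "\<forall>\<^sub>F n in sequentially. norm (L2_inner \<Omega> (f n) h - L2_inner \<Omega> g h) \<le>
      L2_norm \<Omega> (\<lambda>x. f n x - g x) * L2_norm \<Omega> h"
    by simp
  show "(\<lambda>n. L2_norm \<Omega> (\<lambda>x. f n x - g x) * L2_norm \<Omega> h) \<longlonglongrightarrow> 0"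
    using tendsto_mult_right[OF assms(4), of "L2_norm \<Omega> h"] by simp
qed

section \<open>Weak gradients and Sobolev spaces\<close>

text \<open>
  The pointwise gradient of a differentiable function, as opposed to the chosen representative
  \<open>grad \<Omega> \<phi>\<close> of its weak gradient.
\<close>

definition classical_grad :: "scalar_field \<Rightarrow> vector_field" where
  "classical_grad \<phi> = (\<lambda>x. \<chi> i. partial i \<phi> x)"

lemma classical_grad_nth [simp]: "classical_grad \<phi> x $ i = partial i \<phi> x"
  by (simp add: classical_grad_def)

text \<open>
  Boundedness gives the Poincare inequality and finite measure, openness the fundamental lemma.
\<close>

locale bounded_open_set =
  fixes \<Omega> :: "(real^3) set"
  assumes open_set: "open \<Omega>" and bounded_set: "bounded \<Omega>"
begin

lemma sets_lebesgue: "\<Omega> \<in> sets lebesgue"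
  using open_set by (simp add: borel_open)

lemma finite_measure_on: "finite_measure (lebesgue_on \<Omega>)"
  using open_set bounded_set by (intro finite_measure_lebesgue_on lmeasurable_open)

lemma integral_on_eq_UNIV:
  fixes f :: "real^3 \<Rightarrow> real"
  assumes "\<And>x. x \<notin> \<Omega> \<Longrightarrow> f x = 0"
  shows "(\<integral>x. f x \<partial>lebesgue_on \<Omega>) = (\<integral>x. f x \<partial>lebesgue)"
proof -
  have "(\<lambda>x. if x \<in> \<Omega> then f x else 0) = f" using assms by auto
  then show ?thesis
    using Lebesgue_Measure.integral_restrict_UNIV[OF sets_lebesgue, of f] by simp
qed

lemma test_functions_L2: "\<phi> \<in> test_functions \<Omega> \<Longrightarrow> \<phi> \<in> L2 \<Omega>"
  using L2_bounded_continuous[OF sets_lebesgue] test_functions_continuous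
    test_functions_bounded_support by blast

lemma classical_grad_L2:
  assumes "\<phi> \<in> test_functions \<Omega>"
  shows "classical_grad \<phi> \<in> L2 \<Omega>"
proof (rule L2_bounded_continuous[OF sets_lebesgue])
  show "continuous_on UNIV (classical_grad \<phi>)"
    unfolding classical_grad_def
    using test_functions_continuous[OF test_functions_partial[OF assms]]
    by (intro continuous_on_vec_lambda) simp
  have "{x. classical_grad \<phi> x \<noteq> 0} \<subseteq> closure {x. \<phi> x \<noteq> 0}"
    using partial_support[of _ \<phi>] by (fastforce simp: vec_eq_iff)
  then show "bounded {x. classical_grad \<phi> x \<noteq> 0}"
    using bounded_subset[OF bounded_closure[OF test_functions_bounded_support[OF assms]]] by blast
qed

lemma distr_of_eq_L2_inner: "distr_of \<Omega> f \<phi> = L2_inner \<Omega> f \<phi>"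
  by (simp add: distr_of_def L2_inner_def)

lemma has_weak_grad_iff:
  "has_weak_grad \<Omega> u g \<longleftrightarrow>
    (\<forall>i. \<forall>\<phi>\<in>test_functions \<Omega>. L2_inner \<Omega> (\<lambda>x. g x $ i) \<phi> = - L2_inner \<Omega> u (partial i \<phi>))"
  by (auto simp: has_weak_grad_def distr_partial_def distr_of_eq_L2_inner)

lemma has_weak_grad_test:
  assumes "\<phi> \<in> test_functions \<Omega>"
  shows "has_weak_grad \<Omega> \<phi> (classical_grad \<phi>)"
  unfolding has_weak_grad_iff
proof (intro allI ballI)
  fix i \<psi> assume \<psi>: "\<psi> \<in> test_functions \<Omega>"
  note z = test_functions_eq_0[OF assms] test_functions_eq_0[OF test_functions_partial[OF assms]]
  show "L2_inner \<Omega> (\<lambda>x. classical_grad \<phi> x $ i) \<psi> = - L2_inner \<Omega> \<phi> (partial i \<psi>)"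
    using integral_by_parts[of \<phi> \<psi> i] test_functions_Ck[OF assms, of "Suc 0"]
      test_functions_Ck[OF \<psi>, of "Suc 0"] test_functions_bounded_support[OF assms]
    by (simp add: L2_inner_def integral_on_eq_UNIV z del: Ck.simps)
qed

lemma L2_test_eq_0_imp_ae_eq_0:
  assumes f: "f \<in> L2 \<Omega>" and "\<And>\<phi>. \<phi> \<in> test_functions \<Omega> \<Longrightarrow> L2_inner \<Omega> f \<phi> = 0"
  shows "AE x in lebesgue_on \<Omega>. f x = (0 :: real)"
proof (rule fundamental_lemma_calculus_of_variations[OF open_set])
  interpret finite_measure "lebesgue_on \<Omega>" by (rule finite_measure_on)
  have "(\<lambda>x. 1 :: real) \<in> L2 \<Omega>" by (simp add: L2_def)
  from L2_integrable_inner[OF f this] show "integrable (lebesgue_on \<Omega>) f" by simp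
qed (use assms in \<open>auto simp: L2_inner_def\<close>)

lemma has_weak_grad_unique:
  assumes "g \<in> L2 \<Omega>" "g' \<in> L2 \<Omega>" "has_weak_grad \<Omega> u g" "has_weak_grad \<Omega> u g'"
  shows "ae_eq \<Omega> g g'"
proof -
  have "AE x in lebesgue_on \<Omega>. g x $ i - g' x $ i = 0" for i
  proof (rule L2_test_eq_0_imp_ae_eq_0)
    show "(\<lambda>x. g x $ i - g' x $ i) \<in> L2 \<Omega>"
      by (intro L2_diff L2_vec_nth assms)
    fix \<phi> assume "\<phi> \<in> test_functions \<Omega>"
    then show "L2_inner \<Omega> (\<lambda>x. g x $ i - g' x $ i) \<phi> = 0"
      using assms by (simp add: L2_inner_diff_left L2_vec_nth test_functions_L2 has_weak_grad_iff)
  qed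
  then have "AE x in lebesgue_on \<Omega>. \<forall>i. g x $ i - g' x $ i = 0"
    by (simp add: AE_all_countable)
  then show ?thesis
    unfolding ae_eq_def by eventually_elim (simp add: vec_eq_iff)
qed

lemma H1_L2: "u \<in> H1 \<Omega> \<Longrightarrow> u \<in> L2 \<Omega>"
  by (simp add: H1_def)

lemma
  assumes "u \<in> H1 \<Omega>"
  shows grad_L2: "grad \<Omega> u \<in> L2 \<Omega>" and has_weak_grad_grad: "has_weak_grad \<Omega> u (grad \<Omega> u)"
proof -
  have "\<exists>g. g \<in> L2 \<Omega> \<and> has_weak_grad \<Omega> u g"
    using assms by (auto simp: H1_def)
  from someI_ex[OF this] show "grad \<Omega> u \<in> L2 \<Omega>" "has_weak_grad \<Omega> u (grad \<Omega> u)"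
    by (auto simp: grad_def)
qed

lemma
  assumes "u \<in> L2 \<Omega>" "g \<in> L2 \<Omega>" "has_weak_grad \<Omega> u g"
  shows H1I: "u \<in> H1 \<Omega>" and grad_ae_eqI: "ae_eq \<Omega> (grad \<Omega> u) g"
proof -
  show u: "u \<in> H1 \<Omega>" using assms by (auto simp: H1_def)
  show "ae_eq \<Omega> (grad \<Omega> u) g"
    using assms grad_L2[OF u] has_weak_grad_grad[OF u] by (intro has_weak_grad_unique)
qed

lemma has_weak_grad_add:
  assumes "u \<in> L2 \<Omega>" "v \<in> L2 \<Omega>" "g \<in> L2 \<Omega>" "h \<in> L2 \<Omega>"
    and "has_weak_grad \<Omega> u g" "has_weak_grad \<Omega> v h"
  shows "has_weak_grad \<Omega> (\<lambda>x. u x + v x) (\<lambda>x. g x + h x)"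
  using assms by (simp add: has_weak_grad_iff L2_inner_add_left L2_vec_nth test_functions_L2
      test_functions_partial)

lemma has_weak_grad_cmult:
  "has_weak_grad \<Omega> u g \<Longrightarrow> has_weak_grad \<Omega> (\<lambda>x. c * u x) (\<lambda>x. c *\<^sub>R g x)"
  using L2_inner_scaleR_left[of \<Omega> c "u"] L2_inner_scaleR_left[of \<Omega> c "\<lambda>x. g x $ i" for i]
  by (simp add: has_weak_grad_iff)

lemma
  assumes "u \<in> H1 \<Omega>" "v \<in> H1 \<Omega>"
  shows H1_add: "(\<lambda>x. u x + v x) \<in> H1 \<Omega>"
    and grad_add: "ae_eq \<Omega> (grad \<Omega> (\<lambda>x. u x + v x)) (\<lambda>x. grad \<Omega> u x + grad \<Omega> v x)"
proof -
  note L = H1_L2[OF assms(1)] H1_L2[OF assms(2)] and g = grad_L2[OF assms(1)] grad_L2[OF assms(2)]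
  note w = has_weak_grad_add[OF L g has_weak_grad_grad[OF assms(1)] has_weak_grad_grad[OF assms(2)]]
  show "(\<lambda>x. u x + v x) \<in> H1 \<Omega>"
    and "ae_eq \<Omega> (grad \<Omega> (\<lambda>x. u x + v x)) (\<lambda>x. grad \<Omega> u x + grad \<Omega> v x)"
    by (rule H1I[OF L2_add[OF L] L2_add[OF g] w], rule grad_ae_eqI[OF L2_add[OF L] L2_add[OF g] w])
qed

lemma
  assumes "u \<in> H1 \<Omega>"
  shows H1_cmult: "(\<lambda>x. c * u x) \<in> H1 \<Omega>"
    and grad_cmult: "ae_eq \<Omega> (grad \<Omega> (\<lambda>x. c * u x)) (\<lambda>x. c *\<^sub>R grad \<Omega> u x)"
proof -
  note * = L2_cmult[OF H1_L2[OF assms]] L2_scaleR[OF grad_L2[OF assms]]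
    has_weak_grad_cmult[OF has_weak_grad_grad[OF assms]]
  show "(\<lambda>x. c * u x) \<in> H1 \<Omega>" "ae_eq \<Omega> (grad \<Omega> (\<lambda>x. c * u x)) (\<lambda>x. c *\<^sub>R grad \<Omega> u x)"
    by (rule H1I[OF *], rule grad_ae_eqI[OF *])
qed

lemma
  assumes "u \<in> H1 \<Omega>" "v \<in> H1 \<Omega>"
  shows H1_diff: "(\<lambda>x. u x - v x) \<in> H1 \<Omega>"
    and grad_diff: "ae_eq \<Omega> (grad \<Omega> (\<lambda>x. u x - v x)) (\<lambda>x. grad \<Omega> u x - grad \<Omega> v x)"
proof -
  note v = H1_cmult[OF assms(2), of "-1"] grad_cmult[OF assms(2), of "-1"]
  show "(\<lambda>x. u x - v x) \<in> H1 \<Omega>"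
    using H1_add[OF assms(1) v(1)] by simp
  show "ae_eq \<Omega> (grad \<Omega> (\<lambda>x. u x - v x)) (\<lambda>x. grad \<Omega> u x - grad \<Omega> v x)"
    using grad_add[OF assms(1) v(1)] v(2) unfolding ae_eq_def
    by (auto elim!: AE_mp)
qed

lemma
  assumes "\<phi> \<in> test_functions \<Omega>"
  shows test_functions_H1: "\<phi> \<in> H1 \<Omega>" and grad_test: "ae_eq \<Omega> (grad \<Omega> \<phi>) (classical_grad \<phi>)"
  using assms
  by (auto intro!: H1I grad_ae_eqI test_functions_L2 classical_grad_L2 has_weak_grad_test)

lemma H1_norm_nonneg [simp]: "0 \<le> H1_norm \<Omega> u"
  by (simp add: H1_norm_def)

lemma H1_norm_square: "(H1_norm \<Omega> u)\<^sup>2 = (L2_norm \<Omega> u)\<^sup>2 + (L2_norm \<Omega> (grad \<Omega> u))\<^sup>2"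
  by (simp add: H1_norm_def)

lemma L2_norm_le_H1_norm: "L2_norm \<Omega> u \<le> H1_norm \<Omega> u"
  and L2_norm_grad_le_H1_norm: "L2_norm \<Omega> (grad \<Omega> u) \<le> H1_norm \<Omega> u"
  by (auto simp: H1_norm_def intro!: real_le_rsqrt)

lemma H1_norm_le_sum: "H1_norm \<Omega> u \<le> L2_norm \<Omega> u + L2_norm \<Omega> (grad \<Omega> u)"
  unfolding H1_norm_def by (rule sqrt_sum_squares_le_sum) simp_all

lemma H1_norm_triangle:
  assumes "u \<in> H1 \<Omega>" "v \<in> H1 \<Omega>"
  shows "H1_norm \<Omega> (\<lambda>x. u x + v x) \<le> H1_norm \<Omega> u + H1_norm \<Omega> v"
proof -
  note [simp] = H1_L2[OF assms(1)] H1_L2[OF assms(2)] grad_L2[OF assms(1)] grad_L2[OF assms(2)]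
  have "L2_norm \<Omega> (grad \<Omega> (\<lambda>x. u x + v x)) = L2_norm \<Omega> (\<lambda>x. grad \<Omega> u x + grad \<Omega> v x)"
    by (intro L2_norm_ae_eq grad_add assms grad_L2 H1_add L2_add)
  then have "H1_norm \<Omega> (\<lambda>x. u x + v x) \<le>
      sqrt ((L2_norm \<Omega> u + L2_norm \<Omega> v)\<^sup>2 + (L2_norm \<Omega> (grad \<Omega> u) + L2_norm \<Omega> (grad \<Omega> v))\<^sup>2)"
    unfolding H1_norm_def
    by (intro real_sqrt_le_mono add_mono power_mono) (auto intro!: L2_norm_triangle)
  also have "\<dots> \<le> H1_norm \<Omega> u + H1_norm \<Omega> v"
    unfolding H1_norm_def by (rule real_sqrt_sum_squares_triangle_ineq)
  finally show ?thesis .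
qed

lemma H1_norm_cmult:
  assumes "u \<in> H1 \<Omega>"
  shows "H1_norm \<Omega> (\<lambda>x. c * u x) = \<bar>c\<bar> * H1_norm \<Omega> u"
proof -
  have 1: "L2_norm \<Omega> (grad \<Omega> (\<lambda>x. c * u x)) = \<bar>c\<bar> * L2_norm \<Omega> (grad \<Omega> u)"
    using L2_norm_ae_eq[OF grad_cmult[OF assms] grad_L2[OF H1_cmult[OF assms]]
        L2_scaleR[OF grad_L2[OF assms]], of c] by (simp add: L2_norm_scaleR)
  have 2: "L2_norm \<Omega> (\<lambda>x. c * u x) = \<bar>c\<bar> * L2_norm \<Omega> u"
    using L2_norm_scaleR[of \<Omega> c u] by simp
  show ?thesis
    unfolding H1_norm_def 1 2
    by (simp add: power_mult_distrib real_sqrt_mult flip: distrib_left)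
qed

lemma H1_0_H1: "u \<in> H1_0 \<Omega> \<Longrightarrow> u \<in> H1 \<Omega>"
  by (simp add: H1_0_def)

lemma H1_0_approx:
  assumes "u \<in> H1_0 \<Omega>" "e > 0"
  obtains \<phi> where "\<phi> \<in> test_functions \<Omega>" "H1_norm \<Omega> (\<lambda>x. u x - \<phi> x) < e"
  using assms by (auto simp: H1_0_def)

lemma test_functions_H1_0:
  assumes "\<phi> \<in> test_functions \<Omega>"
  shows "\<phi> \<in> H1_0 \<Omega>"
proof -
  have "H1_norm \<Omega> (\<lambda>x. \<phi> x - \<phi> x) = 0"
    using H1_norm_cmult[OF test_functions_H1[OF assms], of 0] by simp
  then show ?thesis
    using assms test_functions_H1 by (auto simp: H1_0_def intro!: bexI[of _ \<phi>])
qed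

lemma H1_0_add:
  assumes "u \<in> H1_0 \<Omega>" "v \<in> H1_0 \<Omega>"
  shows "(\<lambda>x. u x + v x) \<in> H1_0 \<Omega>"
proof -
  note uv = assms[THEN H1_0_H1]
  have "\<exists>\<phi>\<in>test_functions \<Omega>. H1_norm \<Omega> (\<lambda>x. (u x + v x) - \<phi> x) < e" if "e > 0" for e
  proof -
    have e2: "e / 2 > 0" using that by simp
    obtain \<phi> where \<phi>: "\<phi> \<in> test_functions \<Omega>" "H1_norm \<Omega> (\<lambda>x. u x - \<phi> x) < e / 2"
      using H1_0_approx[OF assms(1) e2] by blast
    obtain \<psi> where \<psi>: "\<psi> \<in> test_functions \<Omega>" "H1_norm \<Omega> (\<lambda>x. v x - \<psi> x) < e / 2"
      using H1_0_approx[OF assms(2) e2] by blast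
    note * = \<phi> \<psi>
    have "H1_norm \<Omega> (\<lambda>x. (u x + v x) - (\<phi> x + \<psi> x)) \<le>
        H1_norm \<Omega> (\<lambda>x. u x - \<phi> x) + H1_norm \<Omega> (\<lambda>x. v x - \<psi> x)"
      using H1_norm_triangle[OF H1_diff[OF uv(1) test_functions_H1[OF *(1)]]
          H1_diff[OF uv(2) test_functions_H1[OF *(3)]]]
      by (simp add: algebra_simps)
    with * show ?thesis
      by (intro bexI[of _ "\<lambda>x. \<phi> x + \<psi> x"] test_functions_add) auto
  qed
  with H1_add[OF uv] show ?thesis by (simp add: H1_0_def)
qed

lemma H1_0_cmult:
  assumes "u \<in> H1_0 \<Omega>"
  shows "(\<lambda>x. c * u x) \<in> H1_0 \<Omega>"
proof -
  note u = assms[THEN H1_0_H1]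
  have "\<exists>\<phi>\<in>test_functions \<Omega>. H1_norm \<Omega> (\<lambda>x. c * u x - \<phi> x) < e" if e: "e > 0" for e
  proof -
    obtain \<phi> where *: "\<phi> \<in> test_functions \<Omega>" "H1_norm \<Omega> (\<lambda>x. u x - \<phi> x) < e / (\<bar>c\<bar> + 1)"
      using H1_0_approx[OF assms, of "e / (\<bar>c\<bar> + 1)"] e by auto
    have "H1_norm \<Omega> (\<lambda>x. c * u x - c * \<phi> x) = \<bar>c\<bar> * H1_norm \<Omega> (\<lambda>x. u x - \<phi> x)"
      using H1_norm_cmult[OF H1_diff[OF u test_functions_H1[OF *(1)]], of c]
      by (simp add: algebra_simps)
    also have "\<dots> \<le> (\<bar>c\<bar> + 1) * H1_norm \<Omega> (\<lambda>x. u x - \<phi> x)"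
      by (intro mult_right_mono) auto
    also have "\<dots> < e"
      using *(2) by (simp add: field_simps)
    finally show ?thesis
      using * by (intro bexI[of _ "\<lambda>x. c * \<phi> x"] test_functions_cmult) auto
  qed
  with H1_cmult[OF u] show ?thesis by (simp add: H1_0_def)
qed

lemma H1_0_diff:
  assumes "u \<in> H1_0 \<Omega>" "v \<in> H1_0 \<Omega>"
  shows "(\<lambda>x. u x - v x) \<in> H1_0 \<Omega>"
  using H1_0_add[OF assms(1) H1_0_cmult[OF assms(2), of "-1"]] by simp

lemma Poincare_test:
  obtains C where "C > 0" "\<And>\<phi>. \<phi> \<in> test_functions \<Omega> \<Longrightarrow>
    L2_norm \<Omega> \<phi> \<le> C * L2_norm \<Omega> (classical_grad \<phi>)"
proof -
  obtain R where R: "R > 0" "\<And>x. x \<in> \<Omega> \<Longrightarrow> norm x \<le> R"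
    using bounded_set unfolding bounded_pos by auto
  show ?thesis
  proof (rule that[of "2 * R"])
    show "2 * R > 0" using R by simp
    fix \<phi> assume \<phi>: "\<phi> \<in> test_functions \<Omega>"
    define i where "i = (1 :: 3)"
    note L = test_functions_L2[OF \<phi>] classical_grad_L2[OF \<phi>]
    have Lp: "partial i \<phi> \<in> L2 \<Omega>"
      by (intro test_functions_L2 test_functions_partial \<phi>)
    have ab: "(\<lambda>x. \<bar>f x\<bar>) \<in> L2 \<Omega>" "L2_norm \<Omega> (\<lambda>x. \<bar>f x\<bar>) = L2_norm \<Omega> f" if "f \<in> L2 \<Omega>"
      for f :: scalar_field
      using that by (auto simp: L2_def L2_norm_def L2_inner_def)
    have "(L2_norm \<Omega> \<phi>)\<^sup>2 = (\<integral>x. (\<phi> x)\<^sup>2 \<partial>lebesgue)"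
      unfolding L2_norm_square L2_inner_def
      using test_functions_eq_0[OF \<phi>] by (simp add: integral_on_eq_UNIV power2_eq_square)
    also have "\<dots> = - 2 * (\<integral>x. x $ i * \<phi> x * partial i \<phi> x \<partial>lebesgue)"
      by (intro integral_square_eq_partial test_functions_Ck[OF \<phi>] test_functions_bounded_support[OF \<phi>])
    also have "\<dots> = - 2 * (\<integral>x. x $ i * \<phi> x * partial i \<phi> x \<partial>lebesgue_on \<Omega>)"
      using test_functions_eq_0[OF \<phi>] by (simp add: integral_on_eq_UNIV)
    also have "\<dots> \<le> 2 * (\<integral>x. R * (\<bar>\<phi> x\<bar> * \<bar>partial i \<phi> x\<bar>) \<partial>lebesgue_on \<Omega>)"
    proof -
      have "\<bar>\<integral>x. x $ i * \<phi> x * partial i \<phi> x \<partial>lebesgue_on \<Omega>\<bar> \<le>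
          (\<integral>x. \<bar>x $ i * \<phi> x * partial i \<phi> x\<bar> \<partial>lebesgue_on \<Omega>)"
        by (rule integral_abs_bound)
      also have "\<dots> \<le> (\<integral>x. R * (\<bar>\<phi> x\<bar> * \<bar>partial i \<phi> x\<bar>) \<partial>lebesgue_on \<Omega>)"
      proof (rule integral_mono_AE')
        show "integrable (lebesgue_on \<Omega>) (\<lambda>x. R * (\<bar>\<phi> x\<bar> * \<bar>partial i \<phi> x\<bar>))"
          using L2_integrable_inner[OF ab(1)[OF L(1)] ab(1)[OF Lp]] by simp
        show "AE x in lebesgue_on \<Omega>. \<bar>x $ i * \<phi> x * partial i \<phi> x\<bar> \<le> R * (\<bar>\<phi> x\<bar> * \<bar>partial i \<phi> x\<bar>)"
        proof (rule AE_I2)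
          fix x assume "x \<in> space (lebesgue_on \<Omega>)"
          then have "\<bar>x $ i\<bar> \<le> R"
            using R(2)[of x] component_le_norm_cart[of x i] by simp
          then have "\<bar>x $ i\<bar> * (\<bar>\<phi> x\<bar> * \<bar>partial i \<phi> x\<bar>) \<le> R * (\<bar>\<phi> x\<bar> * \<bar>partial i \<phi> x\<bar>)"
            by (rule mult_right_mono) simp
          then show "\<bar>x $ i * \<phi> x * partial i \<phi> x\<bar> \<le> R * (\<bar>\<phi> x\<bar> * \<bar>partial i \<phi> x\<bar>)"
            by (simp add: abs_mult mult.assoc)
        qed
      qed (use R in auto)
      finally show ?thesis by linarith
    qed
    also have "\<dots> = 2 * R * L2_inner \<Omega> (\<lambda>x. \<bar>\<phi> x\<bar>) (\<lambda>x. \<bar>partial i \<phi> x\<bar>)"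
      by (simp add: L2_inner_def)
    also have "\<dots> \<le> 2 * R * (L2_norm \<Omega> \<phi> * L2_norm \<Omega> (partial i \<phi>))"
      using L2_Cauchy_Schwarz[OF ab(1)[OF L(1)] ab(1)[OF Lp]] ab(2)[OF L(1)] ab(2)[OF Lp] R(1)
      by (intro mult_left_mono) auto
    also have "\<dots> \<le> 2 * R * (L2_norm \<Omega> \<phi> * L2_norm \<Omega> (classical_grad \<phi>))"
      using L2_norm_vec_nth_le[OF L(2), of i] R(1) by (intro mult_left_mono) auto
    finally have "L2_norm \<Omega> \<phi> * L2_norm \<Omega> \<phi> \<le> L2_norm \<Omega> \<phi> * (2 * R * L2_norm \<Omega> (classical_grad \<phi>))"
      by (simp add: power2_eq_square algebra_simps)
    then show "L2_norm \<Omega> \<phi> \<le> 2 * R * L2_norm \<Omega> (classical_grad \<phi>)"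
      by (rule le_if_square_le_mult) (use R(1) in auto)
  qed
qed

text \<open>The Poincare inequality passes from the test functions to their closure.\<close>

lemma Poincare:
  obtains C where "C > 0" "\<And>u. u \<in> H1_0 \<Omega> \<Longrightarrow> L2_norm \<Omega> u \<le> C * L2_norm \<Omega> (grad \<Omega> u)"
proof -
  obtain C where C: "C > 0" "\<And>\<phi>. \<phi> \<in> test_functions \<Omega> \<Longrightarrow>
      L2_norm \<Omega> \<phi> \<le> C * L2_norm \<Omega> (classical_grad \<phi>)"
    using Poincare_test by blast
  have "L2_norm \<Omega> u \<le> C * L2_norm \<Omega> (grad \<Omega> u)" if u: "u \<in> H1_0 \<Omega>" for u
  proof (rule field_le_epsilon)
    fix e :: real assume e: "e > 0"
    define d where "d = e / (1 + C)"
    have d: "d > 0" "d * (1 + C) = e" using e C(1) by (auto simp: d_def)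
    obtain \<phi> where \<phi>: "\<phi> \<in> test_functions \<Omega>" "H1_norm \<Omega> (\<lambda>x. u x - \<phi> x) < d"
      using H1_0_approx[OF u d(1)] by blast
    note H = H1_0_H1[OF u] test_functions_H1[OF \<phi>(1)]
    have "L2_norm \<Omega> (\<lambda>x. grad \<Omega> u x - classical_grad \<phi> x) = L2_norm \<Omega> (grad \<Omega> (\<lambda>x. u x - \<phi> x))"
    proof (rule L2_norm_ae_eq)
      show "ae_eq \<Omega> (\<lambda>x. grad \<Omega> u x - classical_grad \<phi> x) (grad \<Omega> (\<lambda>x. u x - \<phi> x))"
        using grad_diff[OF H] grad_test[OF \<phi>(1)] unfolding ae_eq_def
        by (auto elim!: AE_mp)
    qed (intro L2_diff grad_L2 H H1_diff classical_grad_L2 \<phi>)+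
    also have "\<dots> \<le> d"
      using \<phi>(2) L2_norm_grad_le_H1_norm[of "\<lambda>x. u x - \<phi> x"] by linarith
    finally have 1: "L2_norm \<Omega> (classical_grad \<phi>) \<le> d + L2_norm \<Omega> (grad \<Omega> u)"
      using L2_norm_triangle_sub[OF classical_grad_L2[OF \<phi>(1)] grad_L2[OF H(1)]]
      by (simp add: L2_norm_minus_commute)
    have "L2_norm \<Omega> u \<le> L2_norm \<Omega> (\<lambda>x. u x - \<phi> x) + L2_norm \<Omega> \<phi>"
      by (intro L2_norm_triangle_sub H1_L2 H)
    also have "\<dots> \<le> d + C * (d + L2_norm \<Omega> (grad \<Omega> u))"
      using \<phi>(2) L2_norm_le_H1_norm[of "\<lambda>x. u x - \<phi> x"] C(2)[OF \<phi>(1)] mult_left_mono[OF 1, of C] C(1)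
      by linarith
    also have "\<dots> = C * L2_norm \<Omega> (grad \<Omega> u) + e"
      using d(2) by (simp add: algebra_simps)
    finally show "L2_norm \<Omega> u \<le> C * L2_norm \<Omega> (grad \<Omega> u) + e" .
  qed
  with C(1) that show ?thesis by blast
qed

end

section \<open>The dual space and the Dirichlet problem\<close>

context bounded_open_set
begin

lemma H_minus1_add:
  "F \<in> H_minus1 \<Omega> \<Longrightarrow> u \<in> H1_0 \<Omega> \<Longrightarrow> v \<in> H1_0 \<Omega> \<Longrightarrow> F (\<lambda>x. u x + v x) = F u + F v"
  and H_minus1_cmult: "F \<in> H_minus1 \<Omega> \<Longrightarrow> u \<in> H1_0 \<Omega> \<Longrightarrow> F (\<lambda>x. c * u x) = c * F u"
  and H_minus1_eq_0: "F \<in> H_minus1 \<Omega> \<Longrightarrow> u \<notin> H1_0 \<Omega> \<Longrightarrow> F u = 0"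
  by (auto simp: H_minus1_def)

lemma H_minus1_diff:
  assumes "F \<in> H_minus1 \<Omega>" "u \<in> H1_0 \<Omega>" "v \<in> H1_0 \<Omega>"
  shows "F (\<lambda>x. u x - v x) = F u - F v"
  using H_minus1_add[OF assms(1,2) H1_0_cmult[OF assms(3), of "-1"]]
    H_minus1_cmult[OF assms(1,3), of "-1"] by simp

lemma H_minus1_bound:
  assumes "F \<in> H_minus1 \<Omega>"
  obtains C where "C \<ge> 0" "\<And>u. u \<in> H1_0 \<Omega> \<Longrightarrow> \<bar>F u\<bar> \<le> C * H1_norm \<Omega> u"
proof -
  obtain C where C: "\<And>u. u \<in> H1_0 \<Omega> \<Longrightarrow> \<bar>F u\<bar> \<le> C * H1_norm \<Omega> u"
    using assms unfolding H_minus1_def by blast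
  have "\<bar>F u\<bar> \<le> \<bar>C\<bar> * H1_norm \<Omega> u" if "u \<in> H1_0 \<Omega>" for u
    using C[OF that] mult_right_mono[OF abs_ge_self H1_norm_nonneg, of C u] by linarith
  then show ?thesis using that[of "\<bar>C\<bar>"] by simp
qed

lemma H_minus1_eqI:
  assumes F: "F \<in> H_minus1 \<Omega>" and G: "G \<in> H_minus1 \<Omega>"
    and eq: "\<And>\<phi>. \<phi> \<in> test_functions \<Omega> \<Longrightarrow> F \<phi> = G \<phi>"
  shows "F = G"
proof
  fix u
  show "F u = G u"
  proof (cases "u \<in> H1_0 \<Omega>")
    case u: True
    obtain C where C: "C \<ge> 0" "\<And>u. u \<in> H1_0 \<Omega> \<Longrightarrow> \<bar>F u\<bar> \<le> C * H1_norm \<Omega> u"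
      using H_minus1_bound[OF F] by blast
    obtain D where D: "D \<ge> 0" "\<And>u. u \<in> H1_0 \<Omega> \<Longrightarrow> \<bar>G u\<bar> \<le> D * H1_norm \<Omega> u"
      using H_minus1_bound[OF G] by blast
    have "\<bar>F u - G u\<bar> \<le> 0 + e" if "e > 0" for e
    proof -
      have "e / (C + D + 1) > 0" using that C(1) D(1) by simp
      then obtain \<phi> where \<phi>: "\<phi> \<in> test_functions \<Omega>" "H1_norm \<Omega> (\<lambda>x. u x - \<phi> x) < e / (C + D + 1)"
        using H1_0_approx[OF u] by blast
      note \<phi>' = test_functions_H1_0[OF \<phi>(1)]
      note d = H1_0_diff[OF u \<phi>']
      have "F u - G u = F (\<lambda>x. u x - \<phi> x) - G (\<lambda>x. u x - \<phi> x)"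
        using eq[OF \<phi>(1)] H_minus1_diff[OF F u \<phi>'] H_minus1_diff[OF G u \<phi>'] by simp
      also have "\<bar>\<dots>\<bar> \<le> (C + D + 1) * H1_norm \<Omega> (\<lambda>x. u x - \<phi> x)"
        using C(2)[OF d] D(2)[OF d] H1_norm_nonneg[of "\<lambda>x. u x - \<phi> x"]
        unfolding distrib_right by linarith
      also have "\<dots> \<le> e"
        using \<phi>(2) C(1) D(1) by (simp add: field_simps)
      finally show ?thesis by simp
    qed
    then have "\<bar>F u - G u\<bar> \<le> 0" by (rule field_le_epsilon)
    then show ?thesis by simp
  qed (simp add: H_minus1_eq_0[OF F] H_minus1_eq_0[OF G])
qed

lemma H_minus1_ofI:
  assumes "F \<in> H_minus1 \<Omega>" "\<And>\<phi>. \<phi> \<in> test_functions \<Omega> \<Longrightarrow> F \<phi> = T \<phi>"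
  shows "H_minus1_of \<Omega> T = F"
  unfolding H_minus1_of_def
  by (rule the_equality) (use assms in \<open>auto intro!: H_minus1_eqI\<close>)

lemma
  assumes "distr_in_H_minus1 \<Omega> T"
  shows H_minus1_of_in: "H_minus1_of \<Omega> T \<in> H_minus1 \<Omega>"
    and H_minus1_of_test: "\<phi> \<in> test_functions \<Omega> \<Longrightarrow> H_minus1_of \<Omega> T \<phi> = T \<phi>"
  using assms H_minus1_ofI unfolding distr_in_H_minus1_def by metis+

lemma zero_H1_0: "(\<lambda>x. 0) \<in> H1_0 \<Omega>"
  by (intro test_functions_H1_0 test_functions_zero)

lemma
  assumes F: "F \<in> H_minus1 \<Omega>"
  shows H_minus1_norm_nonneg: "0 \<le> H_minus1_norm \<Omega> F"
    and H_minus1_norm_bound: "u \<in> H1_0 \<Omega> \<Longrightarrow> \<bar>F u\<bar> \<le> H_minus1_norm \<Omega> F * H1_norm \<Omega> u"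
proof -
  obtain C where C: "C \<ge> 0" "\<And>u. u \<in> H1_0 \<Omega> \<Longrightarrow> \<bar>F u\<bar> \<le> C * H1_norm \<Omega> u"
    using H_minus1_bound[OF F] by blast
  have "\<bar>F v\<bar> \<le> C" if "v \<in> H1_0 \<Omega>" "H1_norm \<Omega> v \<le> 1" for v
    using C(2)[OF that(1)] mult_left_mono[OF that(2) C(1)] by simp
  then have bdd: "bdd_above ((\<lambda>u. \<bar>F u\<bar>) ` {u \<in> H1_0 \<Omega>. H1_norm \<Omega> u \<le> 1})"
    by (auto intro!: bdd_aboveI[of _ C])
  have le: "\<bar>F v\<bar> \<le> H_minus1_norm \<Omega> F" if "v \<in> H1_0 \<Omega>" "H1_norm \<Omega> v \<le> 1" for v
    unfolding H_minus1_norm_def by (rule cSUP_upper[OF _ bdd]) (use that in simp)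
  have "H1_norm \<Omega> (\<lambda>x. 0) = 0"
    using H1_norm_cmult[OF H1_0_H1[OF zero_H1_0], of 0] by simp
  then show nonneg: "0 \<le> H_minus1_norm \<Omega> F"
    using le[OF zero_H1_0] by simp
  show "\<bar>F u\<bar> \<le> H_minus1_norm \<Omega> F * H1_norm \<Omega> u" if u: "u \<in> H1_0 \<Omega>"
  proof (cases "H1_norm \<Omega> u = 0")
    case True
    then show ?thesis using C(2)[OF u] by simp
  next
    case False
    then have pos: "H1_norm \<Omega> u > 0" using H1_norm_nonneg[of u] by linarith
    define t where "t = inverse (H1_norm \<Omega> u)"
    have t: "t > 0" "t * H1_norm \<Omega> u = 1" using pos by (auto simp: t_def)
    have "H1_norm \<Omega> (\<lambda>x. t * u x) = 1"
      using H1_norm_cmult[OF H1_0_H1[OF u], of t] t by simp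
    then have "\<bar>F (\<lambda>x. t * u x)\<bar> \<le> H_minus1_norm \<Omega> F"
      by (intro le H1_0_cmult u) simp
    then have "t * \<bar>F u\<bar> \<le> H_minus1_norm \<Omega> F"
      using H_minus1_cmult[OF F u, of t] t by (simp add: abs_mult)
    then show ?thesis using pos by (simp add: t_def field_simps)
  qed
qed

lemma L2_inner_grad_add:
  assumes "u \<in> H1 \<Omega>" "v \<in> H1 \<Omega>" "w \<in> L2 \<Omega>"
  shows "L2_inner \<Omega> w (grad \<Omega> (\<lambda>x. u x + v x)) = L2_inner \<Omega> w (grad \<Omega> u) + L2_inner \<Omega> w (grad \<Omega> v)"
proof -
  have "L2_inner \<Omega> w (grad \<Omega> (\<lambda>x. u x + v x)) = L2_inner \<Omega> w (\<lambda>x. grad \<Omega> u x + grad \<Omega> v x)"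
    by (intro L2_inner_ae_eq ae_eq_refl grad_add grad_L2 H1_add L2_add assms)
  then show ?thesis using assms by (simp add: L2_inner_add_right grad_L2)
qed

lemma L2_inner_grad_cmult:
  assumes "u \<in> H1 \<Omega>" "w \<in> L2 \<Omega>"
  shows "L2_inner \<Omega> w (grad \<Omega> (\<lambda>x. c * u x)) = c * L2_inner \<Omega> w (grad \<Omega> u)"
proof -
  have "L2_inner \<Omega> w (grad \<Omega> (\<lambda>x. c * u x)) = L2_inner \<Omega> w (\<lambda>x. c *\<^sub>R grad \<Omega> u x)"
    by (intro L2_inner_ae_eq ae_eq_refl grad_cmult grad_L2 H1_cmult L2_scaleR assms)
  then show ?thesis by (simp add: L2_inner_scaleR_right)
qed

lemma L2_inner_grad_test:
  assumes "\<phi> \<in> test_functions \<Omega>" "w \<in> L2 \<Omega>"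
  shows "L2_inner \<Omega> w (grad \<Omega> \<phi>) = L2_inner \<Omega> w (classical_grad \<phi>)"
  by (intro L2_inner_ae_eq ae_eq_refl grad_test grad_L2 test_functions_H1 classical_grad_L2 assms)

text \<open>
  The distributional divergence of a square integrable field, as a member of the dual space.
\<close>

lemma minus_grad_functional_H_minus1:
  assumes w: "w \<in> L2 \<Omega>"
  shows "(\<lambda>v. if v \<in> H1_0 \<Omega> then - L2_inner \<Omega> w (grad \<Omega> v) else 0) \<in> H_minus1 \<Omega>"
proof -
  have "\<bar>L2_inner \<Omega> w (grad \<Omega> v)\<bar> \<le> L2_norm \<Omega> w * H1_norm \<Omega> v" if v: "v \<in> H1_0 \<Omega>" for v
  proof -
    have "\<bar>L2_inner \<Omega> w (grad \<Omega> v)\<bar> \<le> L2_norm \<Omega> w * L2_norm \<Omega> (grad \<Omega> v)"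
      by (intro L2_Cauchy_Schwarz w grad_L2 H1_0_H1 v)
    also have "\<dots> \<le> L2_norm \<Omega> w * H1_norm \<Omega> v"
      by (intro mult_left_mono L2_norm_grad_le_H1_norm) simp
    finally show ?thesis .
  qed
  then have "\<exists>C. \<forall>v\<in>H1_0 \<Omega>. \<bar>L2_inner \<Omega> w (grad \<Omega> v)\<bar> \<le> C * H1_norm \<Omega> v"
    by blast
  moreover have "c = 0 \<or> u \<in> H1_0 \<Omega>" if "(\<lambda>x. c * u x) \<in> H1_0 \<Omega>" for c u
    using H1_0_cmult[OF that, of "inverse c"] by (cases "c = 0") (simp_all add: mult.assoc[symmetric])
  ultimately show ?thesis
    using w by (simp add: H_minus1_def H1_0_add H1_0_cmult H1_0_H1 L2_inner_grad_add L2_inner_grad_cmult)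
qed

lemma classical_grad_add_cmult:
  assumes "\<phi> \<in> test_functions \<Omega>" "\<psi> \<in> test_functions \<Omega>"
  shows "classical_grad (\<lambda>x. \<phi> x + t * \<psi> x) = (\<lambda>x. classical_grad \<phi> x + t *\<^sub>R classical_grad \<psi> x)"
proof -
  have d: "\<phi> differentiable (at x)" "\<psi> differentiable (at x)" for x
    using test_functions_Ck[OF assms(1), of "Suc 0"] test_functions_Ck[OF assms(2), of "Suc 0"] by auto
  show ?thesis
    using d by (simp add: fun_eq_iff vec_eq_iff partial_add partial_mult)
qed

text \<open>
  The Riesz representation theorem for the energy inner product: a minimizing sequence of
  \<open>J \<phi> = |grad \<phi>|\<^sup>2 / 2 + F \<phi>\<close> over the test functions is a Cauchy sequence, because it solves the
  Euler equation up to an error that is controlled by \<open>J - inf J\<close>.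
\<close>

lemma Dirichlet_problem_solvable:
  assumes F: "F \<in> H_minus1 \<Omega>"
  obtains u where "u \<in> H1_0 \<Omega>"
    "\<And>v. v \<in> H1_0 \<Omega> \<Longrightarrow> L2_inner \<Omega> (grad \<Omega> u) (grad \<Omega> v) = - F v"
proof -
  let ?T = "test_functions \<Omega>" and ?G = classical_grad
  obtain P where P: "P > 0" "\<And>\<phi>. \<phi> \<in> ?T \<Longrightarrow> L2_norm \<Omega> \<phi> \<le> P * L2_norm \<Omega> (?G \<phi>)"
    using Poincare_test by blast
  obtain C where C: "C \<ge> 0" "\<And>u. u \<in> H1_0 \<Omega> \<Longrightarrow> \<bar>F u\<bar> \<le> C * H1_norm \<Omega> u"
    using H_minus1_bound[OF F] by blast
  define K where "K = C * (P + 1)"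
  have K: "\<bar>F \<phi>\<bar> \<le> K * L2_norm \<Omega> (?G \<phi>)" if \<phi>: "\<phi> \<in> ?T" for \<phi>
  proof -
    have "L2_norm \<Omega> (grad \<Omega> \<phi>) = L2_norm \<Omega> (?G \<phi>)"
      by (intro L2_norm_ae_eq grad_test grad_L2 test_functions_H1 classical_grad_L2 \<phi>)
    then have "H1_norm \<Omega> \<phi> \<le> (P + 1) * L2_norm \<Omega> (?G \<phi>)"
      using H1_norm_le_sum[of \<phi>] P(2)[OF \<phi>] by (simp add: algebra_simps)
    then show ?thesis
      using C(2)[OF test_functions_H1_0[OF \<phi>]] mult_left_mono[OF _ C(1)]
      unfolding K_def by (metis mult.assoc order_trans)
  qed
  define J where "J \<phi> = L2_inner \<Omega> (?G \<phi>) (?G \<phi>) / 2 + F \<phi>" for \<phi>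
  have comb: "(\<lambda>x. \<phi> x + t * \<psi> x) \<in> ?T" if "\<phi> \<in> ?T" "\<psi> \<in> ?T" for \<phi> \<psi> t
    using that by (intro test_functions_add test_functions_cmult)
  have J_comb: "J (\<lambda>x. \<phi> x + t * \<psi> x) =
      J \<phi> + t * (L2_inner \<Omega> (?G \<phi>) (?G \<psi>) + F \<psi>) + t\<^sup>2 * (L2_inner \<Omega> (?G \<psi>) (?G \<psi>) / 2)"
    if "\<phi> \<in> ?T" "\<psi> \<in> ?T" for \<phi> \<psi> t
  proof -
    have "F (\<lambda>x. \<phi> x + t * \<psi> x) = F \<phi> + t * F \<psi>"
      using that by (simp add: H_minus1_add[OF F] H_minus1_cmult[OF F] test_functions_H1_0
          test_functions_cmult)
    then show ?thesis
      using L2_inner_add_scaleR[OF classical_grad_L2[OF that(1)] classical_grad_L2[OF that(2)], of t]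
      by (simp add: J_def classical_grad_add_cmult[OF that] algebra_simps add_divide_distrib)
  qed
  have J_bound: "- (K\<^sup>2 / 2) \<le> J \<phi>" if "\<phi> \<in> ?T" for \<phi>
  proof -
    have "0 \<le> (L2_norm \<Omega> (?G \<phi>) - K)\<^sup>2" by simp
    then show ?thesis
      using K[OF that] by (simp add: J_def power2_diff algebra_simps flip: L2_norm_square)
  qed
  define m where "m = Inf (J ` ?T)"
  have bdd: "bdd_below (J ` ?T)"
    using J_bound by (intro bdd_belowI2)
  have m_le: "m \<le> J \<phi>" if "\<phi> \<in> ?T" for \<phi>
    unfolding m_def using that by (intro cInf_lower bdd) auto
  have "\<exists>\<phi>\<in>?T. J \<phi> < m + inverse (real (Suc n))" for n
    using cInf_lessD[of "J ` ?T" "m + inverse (real (Suc n))"] test_functions_zero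
    by (auto simp: m_def)
  then obtain \<phi> where \<phi>: "\<And>n. \<phi> n \<in> ?T" and J\<phi>: "\<And>n. J (\<phi> n) < m + inverse (real (Suc n))"
    by metis
  note G\<phi> = classical_grad_L2[OF \<phi>]
  define d where "d n = sqrt (2 * inverse (real (Suc n)))" for n
  have d_lim: "d \<longlonglongrightarrow> 0"
    using tendsto_real_sqrt[OF tendsto_mult_right[OF LIMSEQ_inverse_real_of_nat, of 2]]
    by (simp add: d_def[abs_def] mult.commute)
  have d_pos: "d n \<ge> 0" for n by (simp add: d_def)
  have Euler: "\<bar>L2_inner \<Omega> (?G (\<phi> n)) (?G \<psi>) + F \<psi>\<bar> \<le> d n * L2_norm \<Omega> (?G \<psi>)" if \<psi>: "\<psi> \<in> ?T" for \<psi> n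
  proof (rule power2_le_imp_le)
    have "((L2_inner \<Omega> (?G (\<phi> n)) (?G \<psi>) + F \<psi>) / 2)\<^sup>2 \<le>
        (J (\<phi> n) - m) * (L2_inner \<Omega> (?G \<psi>) (?G \<psi>) / 2)"
      using m_le[OF comb[OF \<phi>[of n] \<psi>]] by (intro discriminant_le) (simp add: J_comb[OF \<phi> \<psi>] algebra_simps add_divide_distrib)
    also have "\<dots> \<le> inverse (real (Suc n)) * (L2_inner \<Omega> (?G \<psi>) (?G \<psi>) / 2)"
      using J\<phi>[of n] by (intro mult_right_mono) (auto simp: L2_inner_nonneg)
    finally show "\<bar>L2_inner \<Omega> (?G (\<phi> n)) (?G \<psi>) + F \<psi>\<bar>\<^sup>2 \<le> (d n * L2_norm \<Omega> (?G \<psi>))\<^sup>2"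
      by (simp add: power_mult_distrib L2_norm_square d_def power_divide)
  qed (simp add: d_pos)
  have Cauchy: "L2_norm \<Omega> (\<lambda>x. ?G (\<phi> i) x - ?G (\<phi> j) x) \<le> d i + d j"
    "L2_norm \<Omega> (\<lambda>x. \<phi> i x - \<phi> j x) \<le> P * (d i + d j)" for i j
  proof -
    define \<psi> where "\<psi> = (\<lambda>x. \<phi> i x - \<phi> j x)"
    have \<psi>: "\<psi> \<in> ?T" and G\<psi>: "?G \<psi> = (\<lambda>x. ?G (\<phi> i) x - ?G (\<phi> j) x)"
      using comb[OF \<phi> \<phi>, of i "-1" j] classical_grad_add_cmult[OF \<phi> \<phi>, of i "-1" j]
      by (simp_all add: \<psi>_def)
    have "L2_norm \<Omega> (?G \<psi>) * L2_norm \<Omega> (?G \<psi>) = L2_inner \<Omega> (?G \<psi>) (?G \<psi>)"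
      using L2_norm_square by (simp add: power2_eq_square)
    also have "\<dots> = L2_inner \<Omega> (?G (\<phi> i)) (?G \<psi>) - L2_inner \<Omega> (?G (\<phi> j)) (?G \<psi>)"
      using L2_inner_diff_left[OF G\<phi> G\<phi> classical_grad_L2[OF \<psi>], of i j] by (simp add: G\<psi>)
    also have "\<dots> \<le> L2_norm \<Omega> (?G \<psi>) * (d i + d j)"
      using Euler[OF \<psi>, of i] Euler[OF \<psi>, of j] by (simp add: abs_le_iff algebra_simps)
    finally have *: "L2_norm \<Omega> (?G \<psi>) \<le> d i + d j"
      by (rule le_if_square_le_mult) (use d_pos[of i] d_pos[of j] in auto)
    then show "L2_norm \<Omega> (\<lambda>x. ?G (\<phi> i) x - ?G (\<phi> j) x) \<le> d i + d j"
      by (simp add: G\<psi>)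
    have "L2_norm \<Omega> \<psi> \<le> P * (d i + d j)"
      using P(2)[OF \<psi>] mult_left_mono[OF *, of P] P(1) by linarith
    then show "L2_norm \<Omega> (\<lambda>x. \<phi> i x - \<phi> j x) \<le> P * (d i + d j)"
      by (simp add: \<psi>_def)
  qed
  have small: "\<exists>N. \<forall>i\<ge>N. \<forall>j\<ge>N. D * (d i + d j) < e" if "e > 0" "D > 0" for e D
  proof -
    have "e / (2 * D) > 0" using that by simp
    then obtain N where "\<And>n. n \<ge> N \<Longrightarrow> d n < e / (2 * D)"
      using LIMSEQ_D[OF d_lim] d_pos by fastforce
    then have "D * (d i + d j) < e" if "i \<ge> N" "j \<ge> N" for i j
      using that \<open>D > 0\<close> add_strict_mono[of "d i" "e / (2 * D)" "d j" "e / (2 * D)"]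
      by (simp add: field_simps)
    then show ?thesis by blast
  qed
  obtain g where g: "g \<in> L2 \<Omega>" "(\<lambda>n. L2_norm \<Omega> (\<lambda>x. ?G (\<phi> n) x - g x)) \<longlonglongrightarrow> 0"
  proof (rule L2_complete[OF finite_measure_on G\<phi>])
    fix e :: real assume "e > 0"
    then show "\<exists>N. \<forall>i\<ge>N. \<forall>j\<ge>N. L2_norm \<Omega> (\<lambda>x. ?G (\<phi> i) x - ?G (\<phi> j) x) < e"
      using small[of e 1] le_less_trans[OF Cauchy(1)] by fastforce
  qed
  obtain u where u: "u \<in> L2 \<Omega>" "(\<lambda>n. L2_norm \<Omega> (\<lambda>x. \<phi> n x - u x)) \<longlonglongrightarrow> 0"
  proof (rule L2_complete[OF finite_measure_on test_functions_L2[OF \<phi>]])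
    fix e :: real assume "e > 0"
    then show "\<exists>N. \<forall>i\<ge>N. \<forall>j\<ge>N. L2_norm \<Omega> (\<lambda>x. \<phi> i x - \<phi> j x) < e"
      using small[of e P] P(1) le_less_trans[OF Cauchy(2)] by blast
  qed
  have weak: "has_weak_grad \<Omega> u g"
    unfolding has_weak_grad_iff
  proof (intro allI ballI)
    fix i \<psi> assume \<psi>: "\<psi> \<in> ?T"
    have "(\<lambda>n. L2_norm \<Omega> (\<lambda>x. ?G (\<phi> n) x $ i - g x $ i)) \<longlonglongrightarrow> 0"
    proof (rule Lim_null_comparison[OF _ g(2)])
      show "\<forall>\<^sub>F n in sequentially. norm (L2_norm \<Omega> (\<lambda>x. ?G (\<phi> n) x $ i - g x $ i)) \<le>
          L2_norm \<Omega> (\<lambda>x. ?G (\<phi> n) x - g x)"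
        using L2_norm_vec_nth_le[OF L2_diff[OF G\<phi> g(1)], of _ i] by simp
    qed
    then have "(\<lambda>n. L2_inner \<Omega> (\<lambda>x. ?G (\<phi> n) x $ i) \<psi>) \<longlonglongrightarrow> L2_inner \<Omega> (\<lambda>x. g x $ i) \<psi>"
      by (intro L2_inner_tendsto L2_vec_nth g G\<phi> test_functions_L2[OF \<psi>])
    moreover have "L2_inner \<Omega> (\<lambda>x. ?G (\<phi> n) x $ i) \<psi> = - L2_inner \<Omega> (\<phi> n) (partial i \<psi>)" for n
      using has_weak_grad_test[OF \<phi>] \<psi> unfolding has_weak_grad_iff by blast
    moreover have "(\<lambda>n. - L2_inner \<Omega> (\<phi> n) (partial i \<psi>)) \<longlonglongrightarrow> - L2_inner \<Omega> u (partial i \<psi>)"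
      by (intro tendsto_minus L2_inner_tendsto u test_functions_L2 test_functions_partial \<phi> \<psi>)
    ultimately show "L2_inner \<Omega> (\<lambda>x. g x $ i) \<psi> = - L2_inner \<Omega> u (partial i \<psi>)"
      using LIMSEQ_unique by simp
  qed
  note uH1 = H1I[OF u(1) g(1) weak] and gu = grad_ae_eqI[OF u(1) g(1) weak]
  have u0: "u \<in> H1_0 \<Omega>"
  proof -
    have lim: "(\<lambda>n. L2_norm \<Omega> (\<lambda>x. \<phi> n x - u x) + L2_norm \<Omega> (\<lambda>x. ?G (\<phi> n) x - g x)) \<longlonglongrightarrow> 0"
      using tendsto_add[OF u(2) g(2)] by simp
    have le: "H1_norm \<Omega> (\<lambda>x. u x - \<phi> n x) \<le>
        L2_norm \<Omega> (\<lambda>x. \<phi> n x - u x) + L2_norm \<Omega> (\<lambda>x. ?G (\<phi> n) x - g x)" for n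
    proof -
      note H = uH1 test_functions_H1[OF \<phi>[of n]]
      have "L2_norm \<Omega> (grad \<Omega> (\<lambda>x. u x - \<phi> n x)) = L2_norm \<Omega> (\<lambda>x. g x - ?G (\<phi> n) x)"
      proof (rule L2_norm_ae_eq)
        show "ae_eq \<Omega> (grad \<Omega> (\<lambda>x. u x - \<phi> n x)) (\<lambda>x. g x - ?G (\<phi> n) x)"
          using grad_diff[OF H] grad_test[OF \<phi>[of n]] gu unfolding ae_eq_def
          by eventually_elim simp
      qed (intro L2_diff grad_L2 H H1_diff G\<phi> g)+
      then show ?thesis
        using H1_norm_le_sum[of "\<lambda>x. u x - \<phi> n x"]
        by (simp add: L2_norm_minus_commute[of \<Omega> u "\<phi> n"]
            L2_norm_minus_commute[of \<Omega> g "?G (\<phi> n)"])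
    qed
    have "(\<lambda>n. H1_norm \<Omega> (\<lambda>x. u x - \<phi> n x)) \<longlonglongrightarrow> 0"
      by (rule Lim_null_comparison[OF _ lim]) (simp add: le)
    then have "\<exists>n. H1_norm \<Omega> (\<lambda>x. u x - \<phi> n x) < e" if "e > 0" for e
      using LIMSEQ_D[of _ 0 e] that by fastforce
    then show ?thesis
      using uH1 \<phi> by (auto simp: H1_0_def)
  qed
  have test: "L2_inner \<Omega> (grad \<Omega> u) (?G \<psi>) = - F \<psi>" if \<psi>: "\<psi> \<in> ?T" for \<psi>
  proof -
    have "(\<lambda>n. L2_inner \<Omega> (?G (\<phi> n)) (?G \<psi>) + F \<psi>) \<longlonglongrightarrow> L2_inner \<Omega> g (?G \<psi>) + F \<psi>"
      by (intro tendsto_add tendsto_const L2_inner_tendsto g G\<phi> classical_grad_L2 \<psi>)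
    moreover have "(\<lambda>n. L2_inner \<Omega> (?G (\<phi> n)) (?G \<psi>) + F \<psi>) \<longlonglongrightarrow> 0"
    proof (rule Lim_null_comparison)
      show "(\<lambda>n. d n * L2_norm \<Omega> (?G \<psi>)) \<longlonglongrightarrow> 0"
        using tendsto_mult_right[OF d_lim, of "L2_norm \<Omega> (?G \<psi>)"] by simp
    qed (use Euler[OF \<psi>] in simp)
    ultimately have "L2_inner \<Omega> g (?G \<psi>) + F \<psi> = 0"
      by (rule LIMSEQ_unique)
    moreover have "L2_inner \<Omega> (grad \<Omega> u) (?G \<psi>) = L2_inner \<Omega> g (?G \<psi>)"
      by (intro L2_inner_ae_eq gu ae_eq_refl grad_L2 uH1 g classical_grad_L2 \<psi>)
    ultimately show ?thesis by simp
  qed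
  \<comment> \<open>Both sides are continuous functionals, so that it suffices to compare them on test functions.\<close>
  have eq: "(\<lambda>v. if v \<in> H1_0 \<Omega> then - L2_inner \<Omega> (grad \<Omega> u) (grad \<Omega> v) else 0) = F"
    by (rule H_minus1_eqI[OF minus_grad_functional_H_minus1[OF grad_L2[OF uH1]] F])
      (simp add: test grad_L2[OF uH1] test_functions_H1_0 L2_inner_grad_test)
  have "L2_inner \<Omega> (grad \<Omega> u) (grad \<Omega> v) = - F v" if "v \<in> H1_0 \<Omega>" for v
    using fun_cong[OF eq, of v] that by simp
  with u0 show ?thesis by (rule that)
qed

end

section \<open>Symmetric tensor fields and the decomposition\<close>

lemma inner_mat_1: "(mat 1 :: real^3^3) \<bullet> mat 1 = 3"
  by (simp add: inner_vec_def mat_def sum_3)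

lemma
  assumes "u \<in> L2 \<Omega>"
  shows times_I_L2: "times_I u \<in> L2 \<Omega>"
    and L2_norm_times_I: "L2_norm \<Omega> (times_I u) = sqrt 3 * L2_norm \<Omega> u"
proof -
  have *: "times_I u x \<bullet> times_I u x = 3 * (u x \<bullet> u x)" for x
    by (simp add: times_I_def inner_mat_1)
  show "times_I u \<in> L2 \<Omega>"
    using assms unfolding L2_iff_inner * by (auto simp: times_I_def[abs_def])
  show "L2_norm \<Omega> (times_I u) = sqrt 3 * L2_norm \<Omega> u"
    by (simp add: L2_norm_def L2_inner_def * real_sqrt_mult)
qed

lemma transpose_times_I: "transpose (times_I u x) = times_I u x"
  by (auto simp: times_I_def transpose_def mat_def vec_eq_iff)

lemma L2_sym_L2: "M \<in> L2_sym \<Omega> \<Longrightarrow> M \<in> L2 \<Omega>"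
  by (simp add: L2_sym_def)

lemma times_I_L2_sym: "u \<in> L2 \<Omega> \<Longrightarrow> times_I u \<in> L2_sym \<Omega>"
  by (simp add: L2_sym_def times_I_L2 transpose_times_I)

lemma L2_sym_add:
  assumes "M \<in> L2_sym \<Omega>" "N \<in> L2_sym \<Omega>"
  shows "(\<lambda>x. M x + N x) \<in> L2_sym \<Omega>"
proof -
  have "AE x in lebesgue_on \<Omega>. transpose (M x) = M x" "AE x in lebesgue_on \<Omega>. transpose (N x) = N x"
    using assms by (simp_all add: L2_sym_def ae_eq_def)
  then have "AE x in lebesgue_on \<Omega>. transpose (M x + N x) = M x + N x"
    by eventually_elim (simp add: transpose_def vec_eq_iff)
  then show ?thesis
    using assms by (simp add: L2_sym_def ae_eq_def L2_add)
qed

lemma L2_sym_diff: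
  assumes "M \<in> L2_sym \<Omega>" "N \<in> L2_sym \<Omega>"
  shows "(\<lambda>x. M x - N x) \<in> L2_sym \<Omega>"
proof -
  have "AE x in lebesgue_on \<Omega>. transpose (M x) = M x" "AE x in lebesgue_on \<Omega>. transpose (N x) = N x"
    using assms by (simp_all add: L2_sym_def ae_eq_def)
  then have "AE x in lebesgue_on \<Omega>. transpose (M x - N x) = M x - N x"
    by eventually_elim (simp add: transpose_def vec_eq_iff)
  then show ?thesis
    using assms by (simp add: L2_sym_def ae_eq_def L2_diff)
qed

context bounded_open_set
begin

lemma L2_sym_ae_eq:
  assumes "M \<in> L2_sym \<Omega>" "ae_eq \<Omega> M N"
  shows "N \<in> L2_sym \<Omega>"
proof -
  have "AE x in lebesgue_on \<Omega>. transpose (M x) = M x" "AE x in lebesgue_on \<Omega>. M x = N x"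
    using assms by (simp_all add: L2_sym_def ae_eq_def)
  then have "AE x in lebesgue_on \<Omega>. transpose (N x) = N x"
    by eventually_elim simp
  then show ?thesis
    using assms L2_ae_eq[OF sets_lebesgue assms(2)] by (simp add: L2_sym_def ae_eq_def)
qed

lemma divDiv_eq:
  "divDiv \<Omega> M \<phi> = (\<Sum>i\<in>UNIV. \<Sum>j\<in>UNIV. L2_inner \<Omega> (\<lambda>x. M x $ i $ j) (partial j (partial i \<phi>)))"
  by (simp add: divDiv_def distr_Div_def distr_div_def distr_partial_def distr_of_eq_L2_inner sum_negf)

lemma divDiv_diff:
  assumes "M \<in> L2 \<Omega>" "N \<in> L2 \<Omega>" "\<phi> \<in> test_functions \<Omega>"
  shows "divDiv \<Omega> (\<lambda>x. M x - N x) \<phi> = divDiv \<Omega> M \<phi> - divDiv \<Omega> N \<phi>"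
  using assms by (simp add: divDiv_eq L2_inner_diff_left L2_vec_nth test_functions_L2
      test_functions_partial sum_subtractf)

lemma divDiv_ae_eq:
  assumes MN: "ae_eq \<Omega> M N" and M: "M \<in> L2 \<Omega>" and \<phi>: "\<phi> \<in> test_functions \<Omega>"
  shows "divDiv \<Omega> M \<phi> = divDiv \<Omega> N \<phi>"
proof -
  have N: "N \<in> L2 \<Omega>" by (rule L2_ae_eq[OF sets_lebesgue MN M])
  have "ae_eq \<Omega> (\<lambda>x. M x $ i $ j) (\<lambda>x. N x $ i $ j)" for i j
    using MN unfolding ae_eq_def by eventually_elim simp
  then have "L2_inner \<Omega> (\<lambda>x. M x $ i $ j) (partial j (partial i \<phi>)) =
      L2_inner \<Omega> (\<lambda>x. N x $ i $ j) (partial j (partial i \<phi>))" for i j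
    by (intro L2_inner_ae_eq ae_eq_refl L2_vec_nth M N test_functions_L2 test_functions_partial \<phi>)
  then show ?thesis by (simp add: divDiv_eq)
qed

lemma L2_inner_vec_eq_sum:
  fixes f g :: vector_field
  assumes "f \<in> L2 \<Omega>" "g \<in> L2 \<Omega>"
  shows "L2_inner \<Omega> f g = (\<Sum>i\<in>UNIV. L2_inner \<Omega> (\<lambda>x. f x $ i) (\<lambda>x. g x $ i))"
  unfolding L2_inner_def inner_vec_def[where 'b=3]
  using L2_integrable_inner[OF L2_vec_nth[OF assms(1)] L2_vec_nth[OF assms(2)]]
  by (intro Bochner_Integration.integral_sum) auto

text \<open>\<open>divDiv (u I)\<close> is the Laplacian of \<open>u\<close>.\<close>

lemma divDiv_times_I:
  assumes u: "u \<in> H1 \<Omega>" and \<phi>: "\<phi> \<in> test_functions \<Omega>"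
  shows "divDiv \<Omega> (times_I u) \<phi> = - L2_inner \<Omega> (grad \<Omega> u) (classical_grad \<phi>)"
proof -
  have "L2_inner \<Omega> (\<lambda>x. times_I u x $ i $ j) \<psi> = (if i = j then L2_inner \<Omega> u \<psi> else 0)" for i j \<psi>
    by (simp add: times_I_def mat_def L2_inner_def)
  then have "divDiv \<Omega> (times_I u) \<phi> = (\<Sum>i\<in>UNIV. L2_inner \<Omega> u (partial i (partial i \<phi>)))"
    by (simp add: divDiv_eq)
  also have "\<dots> = (\<Sum>i\<in>UNIV. - L2_inner \<Omega> (\<lambda>x. grad \<Omega> u x $ i) (partial i \<phi>))"
    using has_weak_grad_grad[OF u] test_functions_partial[OF \<phi>] by (simp add: has_weak_grad_iff)
  also have "\<dots> = - L2_inner \<Omega> (grad \<Omega> u) (classical_grad \<phi>)"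
    using L2_inner_vec_eq_sum[OF grad_L2[OF u] classical_grad_L2[OF \<phi>]] by (simp add: sum_negf)
  finally show ?thesis .
qed

lemma H_sym_divDiv0_ae_eq:
  assumes "M \<in> H_sym_divDiv0 \<Omega>" "ae_eq \<Omega> M N"
  shows "N \<in> H_sym_divDiv0 \<Omega>"
  using assms L2_sym_ae_eq[of M N] divDiv_ae_eq[OF assms(2)]
  by (auto simp: H_sym_divDiv0_def L2_sym_L2)

text \<open>
  Both sides of the Dirichlet problem are continuous functionals, so that it may be tested with
  test functions only; there it says that \<open>divDiv M\<close> and \<open>divDiv (u I)\<close> agree.
\<close>

lemma solves_dirichlet_poisson_iff:
  assumes M: "M \<in> H_sym_divDiv \<Omega>"
  shows "solves_dirichlet_poisson \<Omega> M u \<longleftrightarrow>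
    u \<in> H1_0 \<Omega> \<and> (\<lambda>x. M x - times_I u x) \<in> H_sym_divDiv0 \<Omega>"
proof (cases "u \<in> H1_0 \<Omega>")
  case u: True
  let ?F = "\<lambda>v. if v \<in> H1_0 \<Omega> then - L2_inner \<Omega> (grad \<Omega> u) (grad \<Omega> v) else 0"
  note uH1 = H1_0_H1[OF u]
  have d: "distr_in_H_minus1 \<Omega> (divDiv \<Omega> M)" and Ms: "M \<in> L2_sym \<Omega>"
    using M by (auto simp: H_sym_divDiv_def)
  have F: "?F \<in> H_minus1 \<Omega>"
    by (intro minus_grad_functional_H_minus1 grad_L2 uH1)
  have D: "divDiv_H_minus1 \<Omega> M \<in> H_minus1 \<Omega>"
    "\<And>\<phi>. \<phi> \<in> test_functions \<Omega> \<Longrightarrow> divDiv_H_minus1 \<Omega> M \<phi> = divDiv \<Omega> M \<phi>"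
    using H_minus1_of_in[OF d] H_minus1_of_test[OF d] by (auto simp: divDiv_H_minus1_def)
  have "solves_dirichlet_poisson \<Omega> M u \<longleftrightarrow> (\<forall>v\<in>H1_0 \<Omega>. divDiv_H_minus1 \<Omega> M v = ?F v)"
    using u by (auto simp: solves_dirichlet_poisson_def)
  also have "\<dots> \<longleftrightarrow> (\<forall>\<phi>\<in>test_functions \<Omega>. divDiv \<Omega> M \<phi> = ?F \<phi>)"
  proof
    assume "\<forall>v\<in>H1_0 \<Omega>. divDiv_H_minus1 \<Omega> M v = ?F v"
    then show "\<forall>\<phi>\<in>test_functions \<Omega>. divDiv \<Omega> M \<phi> = ?F \<phi>"
      by (simp add: test_functions_H1_0 flip: D(2))
  next
    assume test: "\<forall>\<phi>\<in>test_functions \<Omega>. divDiv \<Omega> M \<phi> = ?F \<phi>"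
    have "divDiv_H_minus1 \<Omega> M = ?F"
      by (rule H_minus1_eqI[OF D(1) F]) (use D(2) test in simp)
    then show "\<forall>v\<in>H1_0 \<Omega>. divDiv_H_minus1 \<Omega> M v = ?F v"
      by simp
  qed
  also have "\<dots> \<longleftrightarrow> (\<forall>\<phi>\<in>test_functions \<Omega>. divDiv \<Omega> (\<lambda>x. M x - times_I u x) \<phi> = 0)"
    by (intro ball_cong refl)
      (simp add: divDiv_diff divDiv_times_I L2_sym_L2[OF Ms] times_I_L2 H1_L2 uH1
        test_functions_H1_0 L2_inner_grad_test grad_L2 eq_neg_iff_add_eq_0)
  also have "\<dots> \<longleftrightarrow> (\<lambda>x. M x - times_I u x) \<in> H_sym_divDiv0 \<Omega>"
    using L2_sym_diff[OF Ms times_I_L2_sym[OF H1_L2[OF uH1]]] by (simp add: H_sym_divDiv0_def)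
  finally show ?thesis using u by simp
qed (simp add: solves_dirichlet_poisson_def)

lemma dirichlet_poisson_unique:
  assumes "solves_dirichlet_poisson \<Omega> M u" "solves_dirichlet_poisson \<Omega> M v"
  shows "ae_eq \<Omega> u v"
proof -
  have u: "u \<in> H1_0 \<Omega>" and v: "v \<in> H1_0 \<Omega>"
    using assms by (auto simp: solves_dirichlet_poisson_def)
  define w where "w = (\<lambda>x. u x - v x)"
  have w: "w \<in> H1_0 \<Omega>" unfolding w_def by (intro H1_0_diff u v)
  note L = grad_L2[OF H1_0_H1[OF u]] grad_L2[OF H1_0_H1[OF v]] grad_L2[OF H1_0_H1[OF w]]
  have "L2_inner \<Omega> (grad \<Omega> w) (grad \<Omega> w) = L2_inner \<Omega> (\<lambda>x. grad \<Omega> u x - grad \<Omega> v x) (grad \<Omega> w)"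
    using grad_diff[OF H1_0_H1[OF u] H1_0_H1[OF v]]
    by (intro L2_inner_ae_eq ae_eq_refl L L2_diff) (simp add: w_def)
  also have "\<dots> = 0"
    using assms w L by (simp add: L2_inner_diff_left solves_dirichlet_poisson_def)
  finally have "L2_norm \<Omega> (grad \<Omega> w) = 0"
    by (simp add: L2_norm_def)
  moreover obtain C where "L2_norm \<Omega> w \<le> C * L2_norm \<Omega> (grad \<Omega> w)"
    using Poincare w by metis
  ultimately have "L2_norm \<Omega> w = 0"
    using L2_norm_nonneg[of \<Omega> w] by simp
  then have "ae_eq \<Omega> w (\<lambda>x. 0)"
    by (intro L2_norm_eq_0_imp_ae_0 H1_L2 H1_0_H1 w)
  then show ?thesis by (simp add: ae_eq_def w_def)
qed

text \<open>
  Conversely, every decomposition is the one given by the Dirichlet problem; this is the source of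
  uniqueness.
\<close>

lemma decomposition_in_H_sym_divDiv:
  assumes u: "u \<in> H1_0 \<Omega>" and M0: "M0 \<in> H_sym_divDiv0 \<Omega>"
    and ae: "ae_eq \<Omega> M (\<lambda>x. times_I u x + M0 x)"
  shows "M \<in> H_sym_divDiv \<Omega>" and "solves_dirichlet_poisson \<Omega> M u"
proof -
  let ?F = "\<lambda>v. if v \<in> H1_0 \<Omega> then - L2_inner \<Omega> (grad \<Omega> u) (grad \<Omega> v) else 0"
  note uH1 = H1_0_H1[OF u]
  note I = times_I_L2_sym[OF H1_L2[OF uH1]]
  have M0s: "M0 \<in> L2_sym \<Omega>" using M0 by (simp add: H_sym_divDiv0_def)
  have M: "M \<in> L2_sym \<Omega>"
    using L2_sym_ae_eq[OF L2_sym_add[OF I M0s] ae_eq_sym[OF ae]] .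
  have "ae_eq \<Omega> M0 (\<lambda>x. M x - times_I u x)"
    using ae unfolding ae_eq_def by eventually_elim simp
  then have diff: "(\<lambda>x. M x - times_I u x) \<in> H_sym_divDiv0 \<Omega>"
    by (rule H_sym_divDiv0_ae_eq[OF M0])
  have "?F \<phi> = divDiv \<Omega> M \<phi>" if \<phi>: "\<phi> \<in> test_functions \<Omega>" for \<phi>
  proof -
    have "divDiv \<Omega> M \<phi> = divDiv \<Omega> (times_I u) \<phi>"
      using diff divDiv_diff[OF L2_sym_L2[OF M] L2_sym_L2[OF I] \<phi>] \<phi>
      by (simp add: H_sym_divDiv0_def)
    then show ?thesis
      using \<phi> by (simp add: divDiv_times_I uH1 test_functions_H1_0 L2_inner_grad_test grad_L2)
  qed
  then have "distr_in_H_minus1 \<Omega> (divDiv \<Omega> M)"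
    unfolding distr_in_H_minus1_def
    by (intro bexI[of _ ?F] minus_grad_functional_H_minus1 grad_L2 uH1) auto
  with M show "M \<in> H_sym_divDiv \<Omega>" by (simp add: H_sym_divDiv_def)
  then show "solves_dirichlet_poisson \<Omega> M u"
    using u diff by (simp add: solves_dirichlet_poisson_iff)
qed

lemma dirichlet_poisson_solvable:
  assumes "M \<in> H_sym_divDiv \<Omega>"
  obtains u where "solves_dirichlet_poisson \<Omega> M u"
proof -
  have "divDiv_H_minus1 \<Omega> M \<in> H_minus1 \<Omega>"
    using assms H_minus1_of_in by (simp add: H_sym_divDiv_def divDiv_H_minus1_def)
  then obtain u where "u \<in> H1_0 \<Omega>"
    "\<And>v. v \<in> H1_0 \<Omega> \<Longrightarrow> L2_inner \<Omega> (grad \<Omega> u) (grad \<Omega> v) = - divDiv_H_minus1 \<Omega> M v"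
    using Dirichlet_problem_solvable by blast
  then show ?thesis
    using that by (auto simp: solves_dirichlet_poisson_def)
qed

lemma direct_sum:
  "is_direct_sum \<Omega> (H_sym_divDiv \<Omega>) (H1_0_I \<Omega>) (H_sym_divDiv0 \<Omega>)"
  unfolding is_direct_sum_def
proof (intro conjI ballI equalityI subsetI)
  fix M assume M: "M \<in> H_sym_divDiv \<Omega>"
  obtain u where u: "solves_dirichlet_poisson \<Omega> M u"
    using dirichlet_poisson_solvable[OF M] .
  have "times_I u \<in> H1_0_I \<Omega>"
    using u ae_eq_refl unfolding H1_0_I_def solves_dirichlet_poisson_def by blast
  moreover have "(\<lambda>x. M x - times_I u x) \<in> H_sym_divDiv0 \<Omega>"
    using u by (simp add: solves_dirichlet_poisson_iff[OF M])
  ultimately show "M \<in> {\<lambda>x. P x + Q x |P Q. P \<in> H1_0_I \<Omega> \<and> Q \<in> H_sym_divDiv0 \<Omega>}"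
    by (intro CollectI exI[of _ "times_I u"] exI[of _ "\<lambda>x. M x - times_I u x"]) simp
next
  fix M assume "M \<in> {\<lambda>x. P x + Q x |P Q. P \<in> H1_0_I \<Omega> \<and> Q \<in> H_sym_divDiv0 \<Omega>}"
  then obtain P Q u where *: "M = (\<lambda>x. P x + Q x)" "Q \<in> H_sym_divDiv0 \<Omega>" "u \<in> H1_0 \<Omega>"
    "ae_eq \<Omega> P (times_I u)"
    by (auto simp: H1_0_I_def)
  have "ae_eq \<Omega> M (\<lambda>x. times_I u x + Q x)"
    using *(4) unfolding *(1) ae_eq_def by eventually_elim simp
  then show "M \<in> H_sym_divDiv \<Omega>"
    by (rule decomposition_in_H_sym_divDiv(1)[OF *(3,2)])
next
  fix P assume P: "P \<in> H1_0_I \<Omega> \<inter> H_sym_divDiv0 \<Omega>"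
  then obtain u where u: "u \<in> H1_0 \<Omega>" "ae_eq \<Omega> P (times_I u)"
    by (auto simp: H1_0_I_def)
  have zero: "times_I (\<lambda>x. 0) = (\<lambda>x. 0)"
    by (simp add: times_I_def[abs_def])
  \<comment> \<open>Both \<open>P = u I + 0\<close> and \<open>P = 0 I + P\<close> are decompositions of \<open>P\<close>.\<close>
  have "(\<lambda>x. 0) \<in> H_sym_divDiv0 \<Omega>"
    using times_I_L2_sym[OF H1_L2[OF H1_0_H1[OF zero_H1_0]]]
    by (simp add: H_sym_divDiv0_def zero divDiv_eq L2_inner_def)
  then have "solves_dirichlet_poisson \<Omega> P u"
    using decomposition_in_H_sym_divDiv(2)[OF u(1), of "\<lambda>x. 0" P] u(2) by simp
  moreover have "solves_dirichlet_poisson \<Omega> P (\<lambda>x. 0)"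
    using decomposition_in_H_sym_divDiv(2)[OF zero_H1_0, of P P] P by (simp add: zero)
  ultimately have "ae_eq \<Omega> u (\<lambda>x. 0)"
    by (rule dirichlet_poisson_unique)
  then show "ae_eq \<Omega> P (\<lambda>x. 0)"
    using u(2) unfolding ae_eq_def by eventually_elim (simp add: times_I_def)
qed

text \<open>
  Testing with the solution itself bounds the energy by the dual norm of the data, and the Poincare
  inequality bounds the \<open>H\<^sup>1\<close> norm by the energy.
\<close>

lemma dirichlet_poisson_stable:
  obtains C where "C > 0" "\<And>M u. M \<in> H_sym_divDiv \<Omega> \<Longrightarrow> solves_dirichlet_poisson \<Omega> M u \<Longrightarrow>
    H1_norm \<Omega> u \<le> C * H_minus1_norm \<Omega> (divDiv_H_minus1 \<Omega> M)"
proof -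
  obtain P where P: "P > 0" "\<And>u. u \<in> H1_0 \<Omega> \<Longrightarrow> L2_norm \<Omega> u \<le> P * L2_norm \<Omega> (grad \<Omega> u)"
    using Poincare by blast
  define C where "C = P\<^sup>2 + 1"
  have C: "C > 0" by (simp add: C_def add_nonneg_pos)
  have "H1_norm \<Omega> u \<le> C * H_minus1_norm \<Omega> (divDiv_H_minus1 \<Omega> M)"
    if M: "M \<in> H_sym_divDiv \<Omega>" and solves: "solves_dirichlet_poisson \<Omega> M u" for M u
  proof (rule le_if_square_le_mult)
    let ?F = "divDiv_H_minus1 \<Omega> M"
    have F: "?F \<in> H_minus1 \<Omega>"
      using M H_minus1_of_in by (simp add: H_sym_divDiv_def divDiv_H_minus1_def)
    have u: "u \<in> H1_0 \<Omega>" and eq: "L2_inner \<Omega> (grad \<Omega> u) (grad \<Omega> u) = - ?F u"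
      using solves by (auto simp: solves_dirichlet_poisson_def)
    have "(L2_norm \<Omega> u)\<^sup>2 \<le> (P * L2_norm \<Omega> (grad \<Omega> u))\<^sup>2"
      by (intro power_mono P u) simp
    then have "H1_norm \<Omega> u * H1_norm \<Omega> u \<le> C * (L2_norm \<Omega> (grad \<Omega> u))\<^sup>2"
      using H1_norm_square[of u] by (simp add: C_def power2_eq_square algebra_simps)
    also have "\<dots> \<le> C * (H_minus1_norm \<Omega> ?F * H1_norm \<Omega> u)"
      using H_minus1_norm_bound[OF F u] C by (intro mult_left_mono) (auto simp: L2_norm_square eq)
    finally show "H1_norm \<Omega> u * H1_norm \<Omega> u \<le> H1_norm \<Omega> u * (C * H_minus1_norm \<Omega> ?F)"
      by (simp add: algebra_simps)
    show "0 \<le> C * H_minus1_norm \<Omega> ?F"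
      using C H_minus1_norm_nonneg[OF F] by simp
  qed simp
  with C that show ?thesis by blast
qed

end

theorem lemma3p21:
  fixes \<Omega> :: "(real^3) set"
  assumes "bounded_strong_lipschitz_domain \<Omega>"
  shows "is_direct_sum \<Omega> (H_sym_divDiv \<Omega>) (H1_0_I \<Omega>) (H_sym_divDiv0 \<Omega>) \<and>
    (\<exists>c>0. \<forall>M\<in>H_sym_divDiv \<Omega>. \<exists>u\<in>H1_0 \<Omega>. \<exists>M0\<in>H_sym_divDiv0 \<Omega>.
       ae_eq \<Omega> M (\<lambda>x. times_I u x + M0 x) \<and>
       (\<forall>u'\<in>H1_0 \<Omega>. \<forall>M0'\<in>H_sym_divDiv0 \<Omega>.
          ae_eq \<Omega> M (\<lambda>x. times_I u' x + M0' x) \<longrightarrow> ae_eq \<Omega> u' u \<and> ae_eq \<Omega> M0' M0) \<and>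
       solves_dirichlet_poisson \<Omega> M u \<and>
       (\<forall>u'. solves_dirichlet_poisson \<Omega> M u' \<longrightarrow> ae_eq \<Omega> u' u) \<and>
       H1_norm \<Omega> u \<le> c * H_minus1_norm \<Omega> (divDiv_H_minus1 \<Omega> M) \<and>
       L2_norm \<Omega> (\<lambda>x. M x - times_I u x) \<le> c * H_sym_divDiv_norm \<Omega> M)"
proof (rule conjI)
  interpret bounded_open_set \<Omega>
    using assms by unfold_locales (auto simp: bounded_strong_lipschitz_domain_def)
  show "is_direct_sum \<Omega> (H_sym_divDiv \<Omega>) (H1_0_I \<Omega>) (H_sym_divDiv0 \<Omega>)"
    by (rule direct_sum)
  obtain C where C: "C > 0" "\<And>M u. M \<in> H_sym_divDiv \<Omega> \<Longrightarrow> solves_dirichlet_poisson \<Omega> M u \<Longrightarrow>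
      H1_norm \<Omega> u \<le> C * H_minus1_norm \<Omega> (divDiv_H_minus1 \<Omega> M)"
    using dirichlet_poisson_stable by blast
  \<comment> \<open>\<open>sqrt 3\<close> is the Frobenius norm of the identity matrix.\<close>
  define c where "c = 1 + sqrt 3 * C"
  have "C \<le> sqrt 3 * C"
    using mult_right_mono[of 1 "sqrt 3" C] C(1) by simp
  then have c: "c > 0" "C \<le> c"
    using C(1) unfolding c_def by linarith+
  show "\<exists>c>0. \<forall>M\<in>H_sym_divDiv \<Omega>. \<exists>u\<in>H1_0 \<Omega>. \<exists>M0\<in>H_sym_divDiv0 \<Omega>.
       ae_eq \<Omega> M (\<lambda>x. times_I u x + M0 x) \<and>
       (\<forall>u'\<in>H1_0 \<Omega>. \<forall>M0'\<in>H_sym_divDiv0 \<Omega>.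
          ae_eq \<Omega> M (\<lambda>x. times_I u' x + M0' x) \<longrightarrow> ae_eq \<Omega> u' u \<and> ae_eq \<Omega> M0' M0) \<and>
       solves_dirichlet_poisson \<Omega> M u \<and>
       (\<forall>u'. solves_dirichlet_poisson \<Omega> M u' \<longrightarrow> ae_eq \<Omega> u' u) \<and>
       H1_norm \<Omega> u \<le> c * H_minus1_norm \<Omega> (divDiv_H_minus1 \<Omega> M) \<and>
       L2_norm \<Omega> (\<lambda>x. M x - times_I u x) \<le> c * H_sym_divDiv_norm \<Omega> M"
  proof (intro exI[of _ c] conjI[OF c(1)] ballI)
    fix M assume M: "M \<in> H_sym_divDiv \<Omega>"
    obtain u where u: "solves_dirichlet_poisson \<Omega> M u"
      using dirichlet_poisson_solvable[OF M] .
    then have u0: "u \<in> H1_0 \<Omega>" and M0: "(\<lambda>x. M x - times_I u x) \<in> H_sym_divDiv0 \<Omega>"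
      by (simp_all add: solves_dirichlet_poisson_iff[OF M])
    let ?N = "H_minus1_norm \<Omega> (divDiv_H_minus1 \<Omega> M)"
    have F: "divDiv_H_minus1 \<Omega> M \<in> H_minus1 \<Omega>" and M_L2: "M \<in> L2 \<Omega>"
      using M H_minus1_of_in by (simp_all add: H_sym_divDiv_def divDiv_H_minus1_def L2_sym_L2)
    have N: "?N \<ge> 0" by (rule H_minus1_norm_nonneg[OF F])
    have uL: "u \<in> L2 \<Omega>" by (intro H1_L2 H1_0_H1 u0)
    have 1: "H1_norm \<Omega> u \<le> c * ?N"
      using C(2)[OF M u] mult_right_mono[OF c(2) N] by linarith
    have "L2_norm \<Omega> (\<lambda>x. M x - times_I u x) \<le> L2_norm \<Omega> M + sqrt 3 * L2_norm \<Omega> u"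
      using L2_norm_triangle_diff[OF M_L2 times_I_L2[OF uL]] by (simp add: L2_norm_times_I[OF uL])
    also have "\<dots> \<le> L2_norm \<Omega> M + sqrt 3 * (C * ?N)"
      using C(2)[OF M u] L2_norm_le_H1_norm[of u] by (intro add_left_mono mult_left_mono) auto
    also have "\<dots> \<le> H_sym_divDiv_norm \<Omega> M + sqrt 3 * (C * H_sym_divDiv_norm \<Omega> M)"
    proof (intro add_mono mult_left_mono)
      show "L2_norm \<Omega> M \<le> H_sym_divDiv_norm \<Omega> M" "?N \<le> H_sym_divDiv_norm \<Omega> M"
        unfolding H_sym_divDiv_norm_def by (auto intro!: real_le_rsqrt)
    qed (use C(1) in auto)
    also have "\<dots> = c * H_sym_divDiv_norm \<Omega> M"
      by (simp add: c_def algebra_simps)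
    finally have 2: "L2_norm \<Omega> (\<lambda>x. M x - times_I u x) \<le> c * H_sym_divDiv_norm \<Omega> M" .
    have 3: "ae_eq \<Omega> u' u \<and> ae_eq \<Omega> M0' (\<lambda>x. M x - times_I u x)"
      if *: "u' \<in> H1_0 \<Omega>" "M0' \<in> H_sym_divDiv0 \<Omega>" "ae_eq \<Omega> M (\<lambda>x. times_I u' x + M0' x)" for u' M0'
    proof -
      have u': "ae_eq \<Omega> u' u"
        using decomposition_in_H_sym_divDiv(2)[OF *] u by (rule dirichlet_poisson_unique)
      moreover have "ae_eq \<Omega> M0' (\<lambda>x. M x - times_I u x)"
        using u' *(3) unfolding ae_eq_def by eventually_elim (simp add: times_I_def)
      ultimately show ?thesis ..
    qed
    show "\<exists>u\<in>H1_0 \<Omega>. \<exists>M0\<in>H_sym_divDiv0 \<Omega>.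
       ae_eq \<Omega> M (\<lambda>x. times_I u x + M0 x) \<and>
       (\<forall>u'\<in>H1_0 \<Omega>. \<forall>M0'\<in>H_sym_divDiv0 \<Omega>.
          ae_eq \<Omega> M (\<lambda>x. times_I u' x + M0' x) \<longrightarrow> ae_eq \<Omega> u' u \<and> ae_eq \<Omega> M0' M0) \<and>
       solves_dirichlet_poisson \<Omega> M u \<and>
       (\<forall>u'. solves_dirichlet_poisson \<Omega> M u' \<longrightarrow> ae_eq \<Omega> u' u) \<and>
       H1_norm \<Omega> u \<le> c * H_minus1_norm \<Omega> (divDiv_H_minus1 \<Omega> M) \<and>
       L2_norm \<Omega> (\<lambda>x. M x - times_I u x) \<le> c * H_sym_divDiv_norm \<Omega> M"
    proof (rule bexI[OF _ u0], rule bexI[OF _ M0], intro conjI ballI allI impI)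
      show "ae_eq \<Omega> M (\<lambda>x. times_I u x + (M x - times_I u x))" by simp
      show "ae_eq \<Omega> u' u" if "solves_dirichlet_poisson \<Omega> M u'" for u'
        using that u by (rule dirichlet_poisson_unique)
    qed (use u 1 2 3 in blast)+
  qed
qed

end
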